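(* Let $n\ge 1$, let $\Delta\subset\mathbb Z^n$ be an additive semigroup (a subset closed under addition), and let $C_\Delta=\bigoplus_{a\in\Delta}C_a$. Then $(C_\Delta,\smile,[\,\cdot\,,\cdot\,],\delta)$ is a differential Gerstenhaber algebra; that is, $C_\Delta$ is closed under the cup product $\smile$, the Gerstenhaber bracket $[\,\cdot\,,\cdot\,]$ and the Hochschild coboundary operator $\delta$ of $C$, and it is a differential Gerstenhaber algebra with the restrictions of these operations.
   Context: Let $A=\mathbb R[x_1,\ldots,x_n]$. For $p\ge 0$ let $C^p$ be the real vector space of multilinear maps $\varphi:A^p\to A$ that are finite sums $\varphi=\sum \varphi_{a_0a_1\ldots a_p}\,x^{a_0}\partial^{a_1}\otimes\cdots\otimes\partial^{a_p}$, with $\varphi_{a_0\ldots a_p}\in\mathbb R$ and multi-indices $a_0,\ldots,a_p\in\mathbb N^n$ ($\mathbb N$ includes $0$), where $x^a=x_1^{a^1}\cdots x_n^{a^n}$, $\partial^a=\partial_1^{a^1}\cdots\partial_n^{a^n}$, $\partial_i=\partial/\partial x_i$, and $(x^{a_0}\partial^{a_1}\otimes\cdots\otimes\partial^{a_p})(u_1,\ldots,u_p)=x^{a_0}(\partial^{a_1}u_1)\cdots(\partial^{a_p}u_p)$. So $C^0=A$. Put $C=\bigoplus_{p\ge0}C^p$. Operations on $C$ (extended linearly), for $\varphi\in C^p$, $\psi\in C^q$: Cup product: $(\varphi\smile\psi)(u_1,\ldots,u_{p+q})=\varphi(u_1,\ldots,u_p)\,\psi(u_{p+1},\ldots,u_{p+q})$.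 Gerstenhaber bracket: $[\varphi,\psi](u_1,\ldots,u_{p+q-1})=\sum_{k=1}^p(-1)^{(k-1)(q-1)}\varphi(u_1,\ldots,u_{k-1},\psi(u_k,\ldots,u_{k+q-1}),u_{k+q},\ldots,u_{p+q-1})-(-1)^{(p-1)(q-1)}\sum_{k=1}^q(-1)^{(k-1)(p-1)}\psi(u_1,\ldots,u_{k-1},\varphi(u_k,\ldots,u_{k+p-1}),u_{k+p},\ldots,u_{p+q-1})$ (empty sums are $0$; the bracket of two elements of $C^0$ is $0$). Hochschild coboundary: $\delta\varphi(u_1,\ldots,u_{p+1})=u_1\varphi(u_2,\ldots,u_{p+1})+\sum_{k=1}^p(-1)^k\varphi(u_1,\ldots,u_{k-1},u_ku_{k+1},u_{k+2},\ldots,u_{p+1})+(-1)^{p+1}\varphi(u_1,\ldots,u_p)u_{p+1}$. The differential Gerstenhaber algebra structure on $C$ is $(C,\smile,[\,\cdot\,,\cdot\,],\delta)$: $\smile$ is associative, $[\varphi,\psi]=-(-1)^{(p+1)(q+1)}[\psi,\varphi]$, the graded Jacobi identity $(-1)^{(p+1)(r+1)}[\varphi,[\psi,\chi]]+\text{cyclic permutations of }(\varphi,\psi,\chi)=0$ holds for $\varphi\in C^p,\psi\in C^q,\chi\in C^r$, and $\delta$ is the Hochschild differential. A subspace of $C$ (graded by $p$) is a differential Gerstenhaber algebra when it is stable under the three operations and equipped with their restrictions. For $a\in\mathbb Z^n$, $C_a\subset C$ is the linear span of all $x^{a_0}\partial^{a_1}\otimes\cdots\otimes\partial^{a_p}$,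 $p\ge0$, with $a_0-\sum_{s=1}^pa_s=a$. One has $C=\bigoplus_{a\in\mathbb Z^n}C_a$. *)

theory Defs
  imports
    "HOL-Analysis.Finite_Cartesian_Product"
    "HOL-Library.Poly_Mapping"
    "HOL-Library.Function_Algebras"
begin

section \<open>Pointwise real vector space structures\<close>

instantiation poly_mapping :: (type, real_vector) real_vector
begin

lift_definition scaleR_poly_mapping :: "real \<Rightarrow> ('a \<Rightarrow>\<^sub>0 'b) \<Rightarrow> ('a \<Rightarrow>\<^sub>0 'b)"
  is "\<lambda>c f k. c *\<^sub>R f k"
  by simp

instance
proof
  fix a b :: real and x y :: "'a \<Rightarrow>\<^sub>0 'b"
  show "a *\<^sub>R (x + y) = a *\<^sub>R x + a *\<^sub>R y"
    by (rule poly_mapping_eqI) (simp add: scaleR_poly_mapping.rep_eq lookup_add scaleR_add_right)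
  show "(a + b) *\<^sub>R x = a *\<^sub>R x + b *\<^sub>R x"
    by (rule poly_mapping_eqI) (simp add: scaleR_poly_mapping.rep_eq lookup_add scaleR_add_left)
  show "a *\<^sub>R b *\<^sub>R x = (a * b) *\<^sub>R x" "1 *\<^sub>R x = x"
    by (rule poly_mapping_eqI, simp add: scaleR_poly_mapping.rep_eq)+
qed

end

instantiation "fun" :: (type, real_vector) real_vector
begin

definition scaleR_fun :: "real \<Rightarrow> ('a \<Rightarrow> 'b) \<Rightarrow> 'a \<Rightarrow> 'b"
  where "scaleR_fun c f = (\<lambda>x. c *\<^sub>R f x)"

instance
  by standard (simp_all add: scaleR_fun_def fun_eq_iff scaleR_add_right scaleR_add_left)

end

section \<open>The polynomial algebra and its partial derivatives\<close>

text \<open>A polynomial is the finitely supported family of its coefficients, indexed by the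
  exponent vectors; the finite type \<^typ>\<open>'n\<close> indexes the variables, so
  \<^term>\<open>n = CARD('n)\<close> is an arbitrary number \<open>\<ge> 1\<close>.\<close>

type_synonym 'n polys = "(nat, 'n) vec \<Rightarrow>\<^sub>0 real"

definition x_pow :: "nat ^ 'n \<Rightarrow> 'n::finite polys"
  where "x_pow a = Poly_Mapping.single a 1"

definition partial :: "'n \<Rightarrow> 'n::finite polys \<Rightarrow> 'n polys"
  where "partial i u = (\<Sum>m\<in>Poly_Mapping.keys u.
           (real (m $ i) * Poly_Mapping.lookup u m) *\<^sub>R x_pow (m - axis i 1))"

text \<open>The fold below does not depend on an order of the variables because partial
  derivatives commute; see \<open>comp_fun_commute_partial\<close>.\<close>

definition partials :: "nat ^ 'n \<Rightarrow> 'n::finite polys \<Rightarrow> 'n polys"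
  where "partials a u = Finite_Set.fold (\<lambda>i. partial i ^^ (a $ i)) u UNIV"

lemma lookup_scaleR_x_pow:
  "Poly_Mapping.lookup (c *\<^sub>R x_pow a) m = (if m = a then c else 0)"
  by (auto simp: scaleR_poly_mapping.rep_eq x_pow_def lookup_single when_def)

lemma lookup_partial:
  "Poly_Mapping.lookup (partial i u) m
     = real (Suc (m $ i)) * Poly_Mapping.lookup u (m + axis i 1)"
proof -
  let ?c = "\<lambda>k. real (k $ i) * Poly_Mapping.lookup u k"
  have eq: "(if m = k - axis i 1 then ?c k else 0) = (if k = m + axis i 1 then ?c k else 0)" for k
  proof (cases "k $ i = 0")
    case True
    then show ?thesis by auto
  next
    case False
    then have "m $ j = (k - axis i 1) $ j \<longleftrightarrow> k $ j = (m + axis i 1) $ j" for j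
      by (auto simp: axis_def)
    then have "m = k - axis i 1 \<longleftrightarrow> k = m + axis i 1"
      unfolding vec_eq_iff by blast
    then show ?thesis by simp
  qed
  have "Poly_Mapping.lookup (partial i u) m
      = (\<Sum>k\<in>Poly_Mapping.keys u. if k = m + axis i 1 then ?c k else 0)"
    by (simp only: partial_def lookup_sum lookup_scaleR_x_pow eq)
  also have "\<dots> = ?c (m + axis i 1)"
    by (simp add: in_keys_iff)
  finally show ?thesis by (simp add: axis_def)
qed

lemma partial_commute: "partial i (partial j u) = partial j (partial i u)"
proof (cases "i = j")
  case False
  then show ?thesis
    by (intro poly_mapping_eqI) (simp add: lookup_partial axis_def add_ac)
qed simp

lemma comp_fun_commute_partial: "comp_fun_commute (\<lambda>i. partial i ^^ (a $ i))"
proof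
  fix i j :: 'a
  have 1: "(partial i ^^ k) (partial j u) = partial j ((partial i ^^ k) u)" for k and u :: "'a polys"
    by (induction k) (auto simp: partial_commute)
  have "(partial i ^^ k) ((partial j ^^ l) u) = (partial j ^^ l) ((partial i ^^ k) u)"
    for k l and u :: "'a polys"
    by (induction l) (auto simp: 1)
  then show "(partial j ^^ (a $ j)) \<circ> (partial i ^^ (a $ i))
      = (partial i ^^ (a $ i)) \<circ> (partial j ^^ (a $ j))"
    by (simp add: fun_eq_iff)
qed

section \<open>Polydifferential cochains\<close>

text \<open>A \<open>p\<close>-cochain is encoded as a function on lists that vanishes on all lists whose
  length is not \<open>p\<close>. The direct sum of the spaces of \<open>p\<close>-cochains then becomes an internal
  one: the degree \<open>p\<close> component of an element is its restriction to the lists of length \<open>p\<close>.\<close>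

type_synonym 'n multiop = "'n polys list \<Rightarrow> 'n polys"

definition monop :: "nat ^ 'n \<Rightarrow> (nat ^ 'n) list \<Rightarrow> 'n::finite multiop"
  where "monop a\<^sub>0 as us =
    (if length us = length as
     then x_pow a\<^sub>0 * (\<Prod>j<length as. partials (as ! j) (us ! j)) else 0)"

definition cochains_deg :: "nat \<Rightarrow> 'n::finite multiop set"
  where "cochains_deg p = span {monop a\<^sub>0 as | a\<^sub>0 as. length as = p}"

definition cochains :: "'n::finite multiop set"
  where "cochains = span (\<Union>p. cochains_deg p)"

definition cochains_weight :: "int ^ 'n \<Rightarrow> 'n::finite multiop set"
  where "cochains_weight a =
    span {monop a\<^sub>0 as | a\<^sub>0 as. \<forall>i. int (a\<^sub>0 $ i) - (\<Sum>s<length as. int ((as ! s) $ i)) = a $ i}"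

definition cochains_over :: "(int ^ 'n) set \<Rightarrow> 'n::finite multiop set"
  where "cochains_over \<Delta> = span (\<Union>a\<in>\<Delta>. cochains_weight a)"

section \<open>Operations\<close>

text \<open>Evaluated on \<open>m\<close> arguments, the bilinear extension of a family of operations between
  degrees \<open>p\<close> and \<open>q\<close> is the sum over the finitely many \<open>p\<close>, \<open>q\<close> for which the result of
  the operation takes \<open>m\<close> arguments. The degree components are selected by the lengths of
  the argument lists.\<close>

definition cup :: "'n::finite multiop \<Rightarrow> 'n multiop \<Rightarrow> 'n multiop"
  where "cup \<phi> \<psi> us = (\<Sum>p\<le>length us. \<phi> (take p us) * \<psi> (drop p us))"

definition insertions :: "nat \<Rightarrow> nat \<Rightarrow> 'n::finite multiop \<Rightarrow> 'n multiop \<Rightarrow> 'n multiop"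
  where "insertions p q \<phi> \<psi> us =
    (\<Sum>k=1..p. (-1) powi ((int k - 1) * (int q - 1)) *\<^sub>R
       \<phi> (take (k - 1) us @ [\<psi> (take q (drop (k - 1) us))] @ drop (k + q - 1) us))"

definition bracket_deg :: "nat \<Rightarrow> nat \<Rightarrow> 'n::finite multiop \<Rightarrow> 'n multiop \<Rightarrow> 'n multiop"
  where "bracket_deg p q \<phi> \<psi> us = insertions p q \<phi> \<psi> us
    - (-1) powi ((int p - 1) * (int q - 1)) *\<^sub>R insertions q p \<psi> \<phi> us"

text \<open>Here \<open>p + q - 1\<close> is the number of arguments; in particular \<open>p = q = 0\<close> never occurs,
  so the bracket of two elements of degree \<open>0\<close> vanishes.\<close>

definition bracket :: "'n::finite multiop \<Rightarrow> 'n multiop \<Rightarrow> 'n multiop"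
  where "bracket \<phi> \<psi> us =
    (\<Sum>p\<le>length us + 1. bracket_deg p (length us + 1 - p) \<phi> \<psi> us)"

definition hochschild :: "'n::finite multiop \<Rightarrow> 'n multiop"
  where "hochschild \<phi> us =
    (if us = [] then 0
     else let p = length us - 1 in
       hd us * \<phi> (tl us)
       + (\<Sum>k=1..p. (-1) ^ k * \<phi> (take (k - 1) us @ [us ! (k - 1) * us ! k] @ drop (k + 1) us))
       + (-1) ^ (p + 1) * (\<phi> (butlast us) * last us))"

lemma cup_homogeneous:
  assumes "\<And>us. length us \<noteq> p \<Longrightarrow> \<phi> us = 0" and "\<And>us. length us \<noteq> q \<Longrightarrow> \<psi> us = 0"
  shows "cup \<phi> \<psi> us = (if length us = p + q then \<phi> (take p us) * \<psi> (drop p us) else 0)"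
proof -
  have "\<phi> (take k us) * \<psi> (drop k us)
      = (if k = p then if length us = p + q then \<phi> (take p us) * \<psi> (drop p us) else 0 else 0)"
    if "k \<le> length us" for k
    using that assms(1)[of "take k us"] assms(2)[of "drop k us"] by auto
  then have "cup \<phi> \<psi> us = (\<Sum>k\<le>length us. if k = p
      then if length us = p + q then \<phi> (take p us) * \<psi> (drop p us) else 0 else 0)"
    unfolding cup_def by (intro sum.cong) auto
  then show ?thesis by simp
qed

lemma bracket_homogeneous:
  assumes "\<And>us. length us \<noteq> p \<Longrightarrow> \<phi> us = 0" and "\<And>us. length us \<noteq> q \<Longrightarrow> \<psi> us = 0"
    and "length us + 1 = p + q"
  shows "bracket \<phi> \<psi> us = bracket_deg p q \<phi> \<psi> us"
proof -
  have 1: "insertions a b f g us = 0"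
    if "length us + 1 = a + b" "\<And>vs. length vs = a \<Longrightarrow> f vs = 0" for a b f g
    unfolding insertions_def using that by (intro sum.neutral ballI) auto
  have "bracket_deg k (length us + 1 - k) \<phi> \<psi> us = (if k = p then bracket_deg p q \<phi> \<psi> us else 0)"
    if "k \<le> length us + 1" for k
  proof (cases "k = p")
    case True
    with assms(3) show ?thesis by simp
  next
    case False
    with that assms show ?thesis
      by (simp add: bracket_deg_def 1)
  qed
  then have "bracket \<phi> \<psi> us = (\<Sum>k\<le>length us + 1. if k = p then bracket_deg p q \<phi> \<psi> us else 0)"
    unfolding bracket_def by (intro sum.cong) auto
  with assms(3) show ?thesis by simp
qed

section \<open>Differential Gerstenhaber algebras of polydifferential cochains\<close>

locale differential_gerstenhaber_algebra =
  fixes S :: "'n::finite multiop set"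
  assumes subspace: "subspace S"
    and subset: "S \<subseteq> cochains"
    and graded: "S = span (\<Union>p. S \<inter> cochains_deg p)"
    and cup_closed: "\<lbrakk>\<phi> \<in> S; \<psi> \<in> S\<rbrakk> \<Longrightarrow> cup \<phi> \<psi> \<in> S"
    and bracket_closed: "\<lbrakk>\<phi> \<in> S; \<psi> \<in> S\<rbrakk> \<Longrightarrow> bracket \<phi> \<psi> \<in> S"
    and hochschild_closed: "\<phi> \<in> S \<Longrightarrow> hochschild \<phi> \<in> S"
    and cup_degree:
      "\<lbrakk>\<phi> \<in> S \<inter> cochains_deg p; \<psi> \<in> S \<inter> cochains_deg q\<rbrakk> \<Longrightarrow> cup \<phi> \<psi> \<in> cochains_deg (p + q)"
    and bracket_degree:
      "\<lbrakk>\<phi> \<in> S \<inter> cochains_deg p; \<psi> \<in> S \<inter> cochains_deg q; p + q = r + 1\<rbrakk>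
        \<Longrightarrow> bracket \<phi> \<psi> \<in> cochains_deg r"
    and bracket_degree_0:
      "\<lbrakk>\<phi> \<in> S \<inter> cochains_deg 0; \<psi> \<in> S \<inter> cochains_deg 0\<rbrakk> \<Longrightarrow> bracket \<phi> \<psi> = 0"
    and hochschild_degree: "\<phi> \<in> S \<inter> cochains_deg p \<Longrightarrow> hochschild \<phi> \<in> cochains_deg (p + 1)"
    and cup_linear:
      "\<lbrakk>\<phi> \<in> S; \<phi>' \<in> S; \<psi> \<in> S\<rbrakk> \<Longrightarrow> cup (c *\<^sub>R \<phi> + \<phi>') \<psi> = c *\<^sub>R cup \<phi> \<psi> + cup \<phi>' \<psi>"
      "\<lbrakk>\<phi> \<in> S; \<psi> \<in> S; \<psi>' \<in> S\<rbrakk> \<Longrightarrow> cup \<phi> (c *\<^sub>R \<psi> + \<psi>') = c *\<^sub>R cup \<phi> \<psi> + cup \<phi> \<psi>'"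
    and bracket_linear:
      "\<lbrakk>\<phi> \<in> S; \<phi>' \<in> S; \<psi> \<in> S\<rbrakk>
        \<Longrightarrow> bracket (c *\<^sub>R \<phi> + \<phi>') \<psi> = c *\<^sub>R bracket \<phi> \<psi> + bracket \<phi>' \<psi>"
      "\<lbrakk>\<phi> \<in> S; \<psi> \<in> S; \<psi>' \<in> S\<rbrakk>
        \<Longrightarrow> bracket \<phi> (c *\<^sub>R \<psi> + \<psi>') = c *\<^sub>R bracket \<phi> \<psi> + bracket \<phi> \<psi>'"
    and hochschild_linear:
      "\<lbrakk>\<phi> \<in> S; \<phi>' \<in> S\<rbrakk>
        \<Longrightarrow> hochschild (c *\<^sub>R \<phi> + \<phi>') = c *\<^sub>R hochschild \<phi> + hochschild \<phi>'"
    and cup_assoc: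
      "\<lbrakk>\<phi> \<in> S; \<psi> \<in> S; \<xi> \<in> S\<rbrakk> \<Longrightarrow> cup (cup \<phi> \<psi>) \<xi> = cup \<phi> (cup \<psi> \<xi>)"
    and bracket_antisym:
      "\<lbrakk>\<phi> \<in> S \<inter> cochains_deg p; \<psi> \<in> S \<inter> cochains_deg q\<rbrakk>
        \<Longrightarrow> bracket \<phi> \<psi> = - ((-1) ^ ((p + 1) * (q + 1)) *\<^sub>R bracket \<psi> \<phi>)"
    and bracket_jacobi:
      "\<lbrakk>\<phi> \<in> S \<inter> cochains_deg p; \<psi> \<in> S \<inter> cochains_deg q; \<xi> \<in> S \<inter> cochains_deg r\<rbrakk>
        \<Longrightarrow> (-1) ^ ((p + 1) * (r + 1)) *\<^sub>R bracket \<phi> (bracket \<psi> \<xi>)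
          + (-1) ^ ((q + 1) * (p + 1)) *\<^sub>R bracket \<psi> (bracket \<xi> \<phi>)
          + (-1) ^ ((r + 1) * (q + 1)) *\<^sub>R bracket \<xi> (bracket \<phi> \<psi>) = 0"
    and hochschild_square: "\<phi> \<in> S \<Longrightarrow> hochschild (hochschild \<phi>) = 0"

end

theory Submission
  imports Defs
begin

text \<open>Two things have to be shown: the operations respect weights, and the Gerstenhaber identities
  hold on all of the cochains, hence on every subspace stable under the operations.

  The weight of \<open>x^a\<^sub>0 \<partial>^a\<^sub>1 \<otimes> \<dots> \<otimes> \<partial>^a\<^sub>p\<close> counts each variable with \<open>1\<close> and each partial derivative
  with \<open>-1\<close>. Multiplying by \<open>x\<^sub>i\<close> raises it by the unit vector \<open>e\<^sub>i\<close>, and by the Leibniz rule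
  composing with \<open>\<partial>\<^sub>i\<close> lowers it by \<open>e\<^sub>i\<close> in every term that arises. Substituting one operator into a
  slot of another composes it with the derivative in this slot and multiplies the result by the
  remaining factors, so weights add under insertion (\<open>circ_cochains_deg_over\<close>) and therefore under
  the bracket; they visibly add under the cup product. The multiplication \<open>u \<otimes> v \<mapsto> u v\<close> is the
  operator \<open>x^0 \<partial>^0 \<otimes> \<partial>^0\<close> of weight \<open>0\<close>, and the Hochschild differential is, up to sign, the
  bracket with it (\<open>hochschild_eq_bracket\<close>), so the differential preserves weights. This is why
  closure of \<open>\<Delta>\<close> under addition suffices, even if \<open>0\<close> is not in \<open>\<Delta>\<close>.

  The identities for the bracket are those of Gerstenhaber. Let \<open>\<circ>\<close> be the signed sum of the
  insertions into all slots. In \<open>(\<phi> \<circ> \<psi>) \<circ> \<xi>\<close> the cochain \<open>\<xi>\<close> is inserted either into an argument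
  of \<open>\<psi>\<close>, which accounts for \<open>\<phi> \<circ> (\<psi> \<circ> \<xi>)\<close>, or into another slot of \<open>\<phi>\<close>; the terms of the
  second kind are graded symmetric in \<open>\<psi>\<close> and \<open>\<xi>\<close> (\<open>associator_symmetric\<close>). The graded commutator
  of such a graded pre-Lie product satisfies the Jacobi identity. Finally the multiplication \<open>\<mu>\<close>
  takes two arguments, so it is odd for the bracket, and \<open>[\<mu>, \<mu>] = 0\<close> by associativity; and the Jacobi identity for \<open>\<mu>, \<mu>, \<phi>\<close> gives
  \<open>2 [\<mu>, [\<mu>, \<phi>]] = 0\<close>, that is, the Hochschild differential squares to zero.\<close>

section \<open>Multilinear cochains and insertion\<close>

definition multilinear :: "'n::finite multiop \<Rightarrow> bool"
  where "multilinear \<phi> \<longleftrightarrow> (\<forall>xs zs. linear (\<lambda>u. \<phi> (xs @ [u] @ zs)))"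

definition homogeneous :: "nat \<Rightarrow> 'n::finite multiop \<Rightarrow> bool"
  where "homogeneous p \<phi> \<longleftrightarrow> (\<forall>us. length us \<noteq> p \<longrightarrow> \<phi> us = 0)"

text \<open>The guard makes the result homogeneous of degree \<open>p + q - 1\<close>. The exponents \<open>i (q + 1)\<close> have the
  parity of \<open>i (q - 1)\<close> and stay within the natural numbers when \<open>q = 0\<close>.\<close>

definition circ :: "nat \<Rightarrow> nat \<Rightarrow> 'n::finite multiop \<Rightarrow> 'n multiop \<Rightarrow> 'n multiop"
  where "circ p q \<phi> \<psi> us = (if length us + 1 = p + q
    then \<Sum>i<p. (-1) ^ (i * (q + 1)) *\<^sub>R \<phi> (take i us @ [\<psi> (take q (drop i us))] @ drop (i + q) us)
    else 0)"

lemma scaleR_fun_apply [simp]: "(c *\<^sub>R f) x = c *\<^sub>R f x"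
  by (simp add: scaleR_fun_def)

lemma sum_fun_apply: "(\<Sum>i\<in>A. f i) x = (\<Sum>i\<in>A. f i x)"
  by (induction A rule: infinite_finite_induct) auto

lemma subspace_multilinear: "subspace {\<phi>. multilinear \<phi>}"
  unfolding subspace_def multilinear_def
  by (auto intro: linear_compose_add linear_compose_scale_right linear_zero)

lemma subspace_homogeneous: "subspace {\<phi>. homogeneous p \<phi>}"
  unfolding subspace_def homogeneous_def by auto

lemma multilinear_slot: "multilinear \<phi> \<Longrightarrow> linear (\<lambda>u. \<phi> (xs @ [u] @ zs))"
  by (simp add: multilinear_def)

lemma split_at_length:
  assumes "length us = a + b"
  obtains xs ys where "us = xs @ ys" "length xs = a" "length ys = b"
  using assms that[of "take a us" "drop a us"] by simp

lemma split_at_lengths: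
  assumes "length us = a + b + c"
  obtains xs ys zs where "us = xs @ ys @ zs" "length xs = a" "length ys = b" "length zs = c"
  using assms by (metis split_at_length append.assoc)

lemma linear_circ_left: "linear (\<lambda>\<phi>. circ p q \<phi> \<psi>)"
  by (intro linearI ext)
    (auto simp: circ_def sum.distrib scaleR_add_right scaleR_sum_right mult.commute)

lemma linear_circ_right:
  assumes "multilinear \<phi>"
  shows "linear (circ p q \<phi>)"
  by (intro linearI ext)
    (auto simp: circ_def sum.distrib scaleR_add_right scaleR_sum_right mult.commute
      linear_add[OF multilinear_slot[OF assms], simplified]
      linear_scale[OF multilinear_slot[OF assms], simplified])

lemma homogeneous_circ: "homogeneous (p + q - 1) (circ p q \<phi> \<psi>)"
  by (auto simp: homogeneous_def circ_def)

lemma minus_one_powi: "(-1::real) powi ((int a - 1) * (int b - 1)) = (-1) ^ ((a + 1) * (b + 1))"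
proof -
  have *: "(-1::real) powi k = (if even k then 1 else -1)" for k
    by (cases k) (auto simp: power_int_minus)
  show ?thesis unfolding * by (auto simp: minus_one_power_iff)
qed

lemma insertions_eq_circ:
  assumes "length us + 1 = p + q"
  shows "insertions p q \<phi> \<psi> us = circ p q \<phi> \<psi> us"
proof -
  have "insertions p q \<phi> \<psi> us = (\<Sum>i<p. (-1) powi ((int (Suc i) - 1) * (int q - 1)) *\<^sub>R
       \<phi> (take i us @ [\<psi> (take q (drop i us))] @ drop (i + q) us))"
    unfolding insertions_def
    by (rule sum.reindex_bij_witness[of _ Suc "\<lambda>k. k - 1"]) auto
  then show ?thesis using assms unfolding minus_one_powi circ_def
    by (auto intro!: sum.cong simp: minus_one_power_iff)
qed

text \<open>On homogeneous cochains only one pair of degrees contributes to the bracket. For any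
  other pair either the outer cochain receives a wrong number of arguments, or the inner one does and
  puts \<open>0\<close> into a slot of the outer one, which is linear in this slot.\<close>

lemma bracket_eq_circ:
  assumes "homogeneous p \<phi>" "multilinear \<phi>" "homogeneous q \<psi>" "multilinear \<psi>"
  shows "bracket \<phi> \<psi> = circ p q \<phi> \<psi> - (-1) ^ ((p + 1) * (q + 1)) *\<^sub>R circ q p \<psi> \<phi>"
proof
  fix us
  show "bracket \<phi> \<psi> us = (circ p q \<phi> \<psi> - (-1) ^ ((p + 1) * (q + 1)) *\<^sub>R circ q p \<psi> \<phi>) us"
  proof (cases "length us + 1 = p + q")
    case True
    then have "bracket \<phi> \<psi> us = bracket_deg p q \<phi> \<psi> us"
      using assms by (intro bracket_homogeneous) (auto simp: homogeneous_def)
    with True show ?thesis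
      by (simp add: bracket_deg_def insertions_eq_circ minus_one_powi add.commute)
  next
    case False
    have ins: "insertions a b f g us = 0"
      if "length us + 1 = a + b" "length us + 1 \<noteq> c + d"
        "homogeneous c f" "multilinear f" "homogeneous d g" for a b c d f g
    proof -
      have "f (take (k - 1) us @ [g (take b (drop (k - 1) us))] @ drop (k + b - 1) us) = 0"
        if k: "k \<in> {1..a}" for k
      proof (cases "a = c")
        case True
        with that \<open>length us + 1 = a + b\<close> \<open>length us + 1 \<noteq> c + d\<close> \<open>homogeneous d g\<close>
        have "g (take b (drop (k - 1) us)) = 0"
          by (auto simp: homogeneous_def)
        then show ?thesis
          using linear_0[OF multilinear_slot[OF \<open>multilinear f\<close>]] by simp
      next
        case False
        with k \<open>length us + 1 = a + b\<close> \<open>homogeneous c f\<close> show ?thesis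
          by (auto simp: homogeneous_def)
      qed
      then show ?thesis by (simp add: insertions_def)
    qed
    have "bracket_deg k (length us + 1 - k) \<phi> \<psi> us = 0" if "k \<le> length us + 1" for k
      unfolding bracket_deg_def
      using that False assms
        ins[of k "length us + 1 - k" p q \<phi> \<psi>] ins[of "length us + 1 - k" k q p \<psi> \<phi>]
      by (simp add: add.commute)
    then have "bracket \<phi> \<psi> us = 0" unfolding bracket_def by (intro sum.neutral) auto
    with False show ?thesis by (simp add: circ_def add.commute)
  qed
qed

lemma bracket_antisymmetric:
  assumes "homogeneous p \<phi>" "multilinear \<phi>" "homogeneous q \<psi>" "multilinear \<psi>"
  shows "bracket \<phi> \<psi> = - ((-1) ^ ((p + 1) * (q + 1)) *\<^sub>R bracket \<psi> \<phi>)"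
proof -
  have "(-1::real) ^ ((q + 1) * (p + 1)) = (-1) ^ ((p + 1) * (q + 1))"
    by (simp only: mult.commute)
  moreover have "e = 1 \<or> e = -1" if "e = (-1) ^ ((p + 1) * (q + 1))" for e :: real
    using that by (simp add: minus_one_power_iff)
  ultimately show ?thesis
    unfolding bracket_eq_circ[OF assms] bracket_eq_circ[OF assms(3,4,1,2)] by fastforce
qed

lemma linear_insertions_left: "linear (\<lambda>\<phi>. insertions p q \<phi> \<psi>)"
  by (intro linearI ext)
    (auto simp: insertions_def sum.distrib scaleR_add_right scaleR_sum_right mult.commute)

lemma linear_insertions_right:
  assumes "multilinear \<phi>"
  shows "linear (insertions p q \<phi>)"
  by (intro linearI ext)
    (auto simp: insertions_def sum.distrib scaleR_add_right scaleR_sum_right mult.commute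
      linear_add[OF multilinear_slot[OF assms], simplified]
      linear_scale[OF multilinear_slot[OF assms], simplified])

lemma linear_bracket_left:
  assumes "multilinear \<psi>"
  shows "linear (\<lambda>\<phi>. bracket \<phi> \<psi>)"
  by (intro linearI ext)
    (simp_all add: bracket_def bracket_deg_def sum.distrib sum_subtractf scaleR_sum_right
      linear_add[OF linear_insertions_left] linear_scale[OF linear_insertions_left]
      linear_add[OF linear_insertions_right[OF assms]] linear_scale[OF linear_insertions_right[OF assms]]
      algebra_simps)

lemma linear_bracket_right:
  assumes "multilinear \<phi>"
  shows "linear (bracket \<phi>)"
  by (intro linearI ext)
    (simp_all add: bracket_def bracket_deg_def sum.distrib sum_subtractf scaleR_sum_right
      linear_add[OF linear_insertions_left] linear_scale[OF linear_insertions_left]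
      linear_add[OF linear_insertions_right[OF assms]] linear_scale[OF linear_insertions_right[OF assms]]
      algebra_simps)

section \<open>The graded pre-Lie identity\<close>

text \<open>The summands insert \<open>\<psi>\<close> into slot \<open>a\<close> and \<open>\<xi>\<close> into a later slot \<open>b\<close> of \<open>\<phi>\<close>. The second
  argument block starts at \<open>b - 1 + q\<close> because \<open>\<psi>\<close> consumes \<open>q\<close> arguments instead of one.\<close>

definition two_insertions ::
    "nat \<Rightarrow> nat \<Rightarrow> nat \<Rightarrow> 'n::finite multiop \<Rightarrow> 'n multiop \<Rightarrow> 'n multiop \<Rightarrow> 'n multiop"
  where "two_insertions p q r \<phi> \<psi> \<xi> us =
    (\<Sum>b<p. \<Sum>a<b. (-1) ^ (a * (q + 1) + b * (r + 1)) *\<^sub>R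
       \<phi> (take a us @ [\<psi> (take q (drop a us))] @ take (b - a - 1) (drop (a + q) us)
          @ [\<xi> (take r (drop (b - 1 + q) us))] @ drop (b - 1 + q + r) us))"

text \<open>In the iterated insertion \<open>\<xi>\<close> lands at a position \<open>j\<close> of the argument list, \<open>\<psi>\<close> at slot \<open>i\<close> of
  \<open>\<phi>\<close>. If \<open>j < i\<close>, then \<open>\<xi>\<close> fills an earlier slot of \<open>\<phi>\<close>; if \<open>i \<le> j < i + q\<close>, it is nested in
  \<open>\<psi>\<close>; otherwise it fills the later slot \<open>j + 1 - q\<close> of \<open>\<phi>\<close>. In the last case the sign is computed
  with the shifted position \<open>j\<close>, which produces the extra factor.\<close>

lemma circ_circ:
  assumes len: "length us + 2 = p + q + r" and "multilinear \<phi>"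
  shows "circ (p + q - 1) r (circ p q \<phi> \<psi>) \<xi> us =
    circ p (q + r - 1) \<phi> (circ q r \<psi> \<xi>) us
    + two_insertions p r q \<phi> \<xi> \<psi> us
    + (-1) ^ ((q + 1) * (r + 1)) *\<^sub>R two_insertions p q r \<phi> \<psi> \<xi> us"
proof (cases "p = 0")
  case True
  have "circ 0 a f g = 0" for a and f g :: "'a multiop" by (auto simp: circ_def)
  with True show ?thesis by (simp add: two_insertions_def linear_0[OF linear_circ_left])
next
  case False
  define L where "L j = take j us @ [\<xi> (take r (drop j us))] @ drop (j + r) us" for j
  define f where "f i j = ((-1) ^ (j * (r + 1)) * (-1) ^ (i * (q + 1))) *\<^sub>R
      \<phi> (take i (L j) @ [\<psi> (take q (drop i (L j)))] @ drop (i + q) (L j))" for i j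
  have "circ (p + q - 1) r (circ p q \<phi> \<psi>) \<xi> us = (\<Sum>j<p+q-1. \<Sum>i<p. f i j)"
  proof -
    have 1: "length us + 1 = p + q - 1 + r" using len False by simp
    have "circ p q \<phi> \<psi> (L j) = (\<Sum>i<p. (-1) ^ (i * (q + 1)) *\<^sub>R
        \<phi> (take i (L j) @ [\<psi> (take q (drop i (L j)))] @ drop (i + q) (L j)))"
      if "j < p + q - 1" for j
    proof -
      have "length (L j) + 1 = p + q" using that len by (simp add: L_def)
      then show ?thesis by (simp add: circ_def)
    qed
    then show ?thesis
      unfolding circ_def[of "p + q - 1"] if_P[OF 1] L_def[symmetric]
      by (simp add: scaleR_sum_right f_def)
  qed
  also have "\<dots> = (\<Sum>i<p. \<Sum>j<p+q-1. f i j)"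
    by (rule sum.swap)
  also have "\<dots> = (\<Sum>i<p. (\<Sum>j<i. f i j) + (\<Sum>l<q. f i (i + l)) + (\<Sum>b=Suc i..<p. f i (b + q - 1)))"
  proof (rule sum.cong[OF refl])
    fix i assume "i \<in> {..<p}"
    then have "{..<p+q-1} = {..<i} \<union> {i..<i+q} \<union> {i+q..<p+q-1}" by auto
    then have "(\<Sum>j<p+q-1. f i j) = (\<Sum>j<i. f i j) + (\<Sum>j=i..<i+q. f i j) + (\<Sum>j=i+q..<p+q-1. f i j)"
      using sum.union_disjoint[of "{..<i} \<union> {i..<i+q}" "{i+q..<p+q-1}" "f i"]
        sum.union_disjoint[of "{..<i}" "{i..<i+q}" "f i"]
      by (simp add: ivl_disj_un ivl_disj_int disjoint_iff)
    moreover have "(\<Sum>j=i..<i+q. f i j) = (\<Sum>l<q. f i (i + l))"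
      by (rule sum.reindex_bij_witness[of _ "\<lambda>l. i + l" "\<lambda>j. j - i"]) auto
    moreover have "(\<Sum>j=i+q..<p+q-1. f i j) = (\<Sum>b=Suc i..<p. f i (b + q - 1))"
      by (rule sum.reindex_bij_witness[of _ "\<lambda>b. b + q - 1" "\<lambda>j. j + 1 - q"]) auto
    ultimately show "(\<Sum>j<p+q-1. f i j)
        = (\<Sum>j<i. f i j) + (\<Sum>l<q. f i (i + l)) + (\<Sum>b=Suc i..<p. f i (b + q - 1))" by simp
  qed
  also have "\<dots> = (\<Sum>i<p. \<Sum>j<i. f i j) + (\<Sum>i<p. \<Sum>l<q. f i (i + l))
      + (\<Sum>i<p. \<Sum>b=Suc i..<p. f i (b + q - 1))"
    by (simp add: sum.distrib)
  \<comment> \<open>Both cochains in slots of \<open>\<phi>\<close>, the inner \<open>\<xi>\<close> first.\<close>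
  also have "(\<Sum>i<p. \<Sum>j<i. f i j) = two_insertions p r q \<phi> \<xi> \<psi> us"
    unfolding two_insertions_def
  proof (intro sum.cong refl)
    fix i j assume "i \<in> {..<p}" "j \<in> {..<i}"
    then have "length us = j + r + (i - j - 1 + q + (p - i - 1))" using len by auto
    then obtain xs ys zs ws vs where us: "us = xs @ ys @ zs @ ws @ vs"
      and l: "length xs = j" "length ys = r" "length zs = i - j - 1" "length ws = q"
      by (elim split_at_lengths) auto
    have i: "i = Suc (j + length zs)" using l \<open>j \<in> {..<i}\<close> by auto
    have "L j = xs @ [\<xi> ys] @ zs @ ws @ vs"
      using l(1,2) by (auto simp: L_def us)
    then show "f i j = (-1) ^ (j * (r + 1) + i * (q + 1)) *\<^sub>R
        \<phi> (take j us @ [\<xi> (take r (drop j us))] @ take (i - j - 1) (drop (j + r) us)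
          @ [\<psi> (take q (drop (i - 1 + r) us))] @ drop (i - 1 + r + q) us)"
      unfolding f_def i using l(1,2,4) by (auto simp: us power_add)
  qed
  \<comment> \<open>Nested insertion: \<open>\<xi>\<close> sits in slot \<open>l = j - i\<close> of \<open>\<psi>\<close>.\<close>
  also have "(\<Sum>i<p. \<Sum>l<q. f i (i + l)) = circ p (q + r - 1) \<phi> (circ q r \<psi> \<xi>) us"
  \<comment> \<open>If both degrees are \<open>0\<close>, then \<open>q + r - 1\<close> is truncated; both sides vanish.\<close>
  proof (cases "q + r = 0")
    case True
    then show ?thesis using linear_0[OF multilinear_slot[OF \<open>multilinear \<phi>\<close>]]
      by (simp add: circ_def)
  next
    case qr: False
    have 1: "length us + 1 = p + (q + r - 1)" using len qr False by arith
    show ?thesis unfolding circ_def[of p] if_P[OF 1]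
    proof (rule sum.cong[OF refl])
      fix i assume "i \<in> {..<p}"
      define V where "V = take (q + r - 1) (drop i us)"
      have "length us = i + (q + r - 1) + (p - i - 1)" using len \<open>i \<in> {..<p}\<close> qr by auto
      then obtain xs zs where us: "us = xs @ V @ zs" and i: "length xs = i"
        by (elim split_at_lengths) (auto simp: V_def)
      have V: "length V + 1 = q + r" using len \<open>i \<in> {..<p}\<close> qr by (auto simp: V_def)
      have d: "drop (i + (q + r - 1)) us = zs" "take i us = xs" using V i by (auto simp: us)
      have "(-1) ^ (i * (q + r - 1 + 1)) *\<^sub>R \<phi> (xs @ [circ q r \<psi> \<xi> V] @ zs)
        = (\<Sum>l<q. ((-1) ^ (i * (q + r)) * (-1) ^ (l * (r + 1))) *\<^sub>R
            \<phi> (xs @ [\<psi> (take l V @ [\<xi> (take r (drop l V))] @ drop (l + r) V)] @ zs))"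
        unfolding circ_def if_P[OF V] linear_sum[OF multilinear_slot[OF \<open>multilinear \<phi>\<close>]]
          linear_scale[OF multilinear_slot[OF \<open>multilinear \<phi>\<close>]]
        using qr by (simp add: scaleR_sum_right)
      also have "\<dots> = (\<Sum>l<q. f i (i + l))"
      proof (rule sum.cong[OF refl])
        fix l assume "l \<in> {..<q}"
        have "length V = l + r + (q - l - 1)" using V \<open>l \<in> {..<q}\<close> by auto
        then obtain as bs cs where V': "V = as @ bs @ cs" and l: "length as = l" "length bs = r"
          by (elim split_at_lengths)
        have q: "q = Suc (l + length cs)" using V \<open>l \<in> {..<q}\<close> l by (auto simp: V')
        have "L (i + l) = xs @ as @ [\<xi> bs] @ cs @ zs"
          using l i by (auto simp: L_def us V')
        then show "((-1) ^ (i * (q + r)) * (-1) ^ (l * (r + 1))) *\<^sub>R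
            \<phi> (xs @ [\<psi> (take l V @ [\<xi> (take r (drop l V))] @ drop (l + r) V)] @ zs) = f i (i + l)"
          unfolding f_def using l i by (auto simp: V' q minus_one_power_iff)
      qed
      finally show "(\<Sum>l<q. f i (i + l)) = (-1) ^ (i * (q + r - 1 + 1)) *\<^sub>R
          \<phi> (take i us @ [circ q r \<psi> \<xi> (take (q + r - 1) (drop i us))] @ drop (i + (q + r - 1)) us)"
        unfolding d V_def by simp
    qed
  qed
  \<comment> \<open>Both cochains in slots of \<open>\<phi>\<close>, now \<open>\<psi>\<close> first.\<close>
  also have "(\<Sum>i<p. \<Sum>b=Suc i..<p. f i (b + q - 1))
      = (-1) ^ ((q + 1) * (r + 1)) *\<^sub>R two_insertions p q r \<phi> \<psi> \<xi> us"
  proof -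
    have "f i (b + q - 1) = ((-1) ^ ((q + 1) * (r + 1)) * (-1) ^ (i * (q + 1) + b * (r + 1))) *\<^sub>R
        \<phi> (take i us @ [\<psi> (take q (drop i us))] @ take (b - i - 1) (drop (i + q) us)
          @ [\<xi> (take r (drop (b - 1 + q) us))] @ drop (b - 1 + q + r) us)"
      if "i < b" "b < p" for i b
    proof -
      have "length us = i + q + (b - i - 1 + r + (p - b - 1))" using len that by auto
      then obtain xs ys zs ws vs where us: "us = xs @ ys @ zs @ ws @ vs"
        and l: "length xs = i" "length ys = q" "length zs = b - i - 1" "length ws = r"
        by (elim split_at_lengths) auto
      have b: "b = Suc (i + length zs)" using l that by auto
      have "L (b + q - 1) = xs @ ys @ zs @ [\<xi> ws] @ vs"
        using l(1,2,4) by (auto simp: L_def us b)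
      then show ?thesis
        unfolding f_def b using l(1,2,4) by (auto simp: us minus_one_power_iff)
    qed
    then have "(\<Sum>i<p. \<Sum>b=Suc i..<p. f i (b + q - 1)) = (\<Sum>i\<in>{..<p}. \<Sum>b\<in>{b\<in>{..<p}. i < b}.
        ((-1) ^ ((q + 1) * (r + 1)) * (-1) ^ (i * (q + 1) + b * (r + 1))) *\<^sub>R
        \<phi> (take i us @ [\<psi> (take q (drop i us))] @ take (b - i - 1) (drop (i + q) us)
          @ [\<xi> (take r (drop (b - 1 + q) us))] @ drop (b - 1 + q + r) us))"
      by (intro sum.cong) auto
    also have "\<dots> = (\<Sum>b\<in>{..<p}. \<Sum>i\<in>{i\<in>{..<p}. i < b}.
        ((-1) ^ ((q + 1) * (r + 1)) * (-1) ^ (i * (q + 1) + b * (r + 1))) *\<^sub>R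
        \<phi> (take i us @ [\<psi> (take q (drop i us))] @ take (b - i - 1) (drop (i + q) us)
          @ [\<xi> (take r (drop (b - 1 + q) us))] @ drop (b - 1 + q + r) us))"
      by (rule sum.swap_restrict) auto
    also have "\<dots> = (\<Sum>b<p. \<Sum>i<b.
        ((-1) ^ ((q + 1) * (r + 1)) * (-1) ^ (i * (q + 1) + b * (r + 1))) *\<^sub>R
        \<phi> (take i us @ [\<psi> (take q (drop i us))] @ take (b - i - 1) (drop (i + q) us)
          @ [\<xi> (take r (drop (b - 1 + q) us))] @ drop (b - 1 + q + r) us))"
      by (intro sum.cong) auto
    finally show ?thesis
      unfolding two_insertions_def scaleR_sum_right scaleR_scaleR .
  qed
  finally show ?thesis by (simp add: add_ac)
qed

definition associator :: "nat \<Rightarrow> nat \<Rightarrow> nat \<Rightarrow> 'n::finite multiop \<Rightarrow> 'n multiop \<Rightarrow> 'n multiop \<Rightarrow> 'n multiop"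
  where "associator p q r \<phi> \<psi> \<xi> =
    circ (p + q - 1) r (circ p q \<phi> \<psi>) \<xi> - circ p (q + r - 1) \<phi> (circ q r \<psi> \<xi>)"

lemma circ_zero_left: "circ p q 0 \<psi> = 0"
  by (rule linear_0[OF linear_circ_left])

text \<open>By \<open>circ_circ\<close> the associator consists of the terms with \<open>\<psi>\<close> and \<open>\<xi>\<close> in different slots of
  \<open>\<phi>\<close>, and exchanging the two cochains permutes these terms up to the sign.\<close>

lemma associator_symmetric:
  assumes "multilinear \<phi>"
  shows "associator p q r \<phi> \<psi> \<xi> = (-1) ^ ((q + 1) * (r + 1)) *\<^sub>R associator p r q \<phi> \<xi> \<psi>"
proof
  fix us
  have 0: "associator p q r \<phi> \<psi> \<xi> us = 0" if "length us + 2 \<noteq> p + q + r" for q r \<psi> \<xi>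
  proof -
    have [simp]: "circ 0 0 f g = 0" for f g :: "'a multiop" by (auto simp: circ_def)
    have "circ (p + q - 1) r (circ p q \<phi> \<psi>) \<xi> us = 0"
    proof (cases "p + q = 0")
      case True then show ?thesis by (simp add: circ_zero_left)
    next
      case False then show ?thesis using that by (auto simp: circ_def)
    qed
    moreover have "circ p (q + r - 1) \<phi> (circ q r \<psi> \<xi>) us = 0"
    proof (cases "q + r = 0")
      case True then show ?thesis by (simp add: linear_0[OF linear_circ_right[OF assms]])
    next
      case False then show ?thesis using that by (auto simp: circ_def)
    qed
    ultimately show ?thesis by (simp add: associator_def)
  qed
  show "associator p q r \<phi> \<psi> \<xi> us = ((-1) ^ ((q + 1) * (r + 1)) *\<^sub>R associator p r q \<phi> \<xi> \<psi>) us"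
  proof (cases "length us + 2 = p + q + r")
    case True
    have *: "x - y = e *\<^sub>R (x' - y')"
      if "x = y + d + e *\<^sub>R d'" "x' = y' + d' + e *\<^sub>R d" "e * e = 1" for x x' y y' d d' :: "'a polys" and e
      using that by (simp add: algebra_simps)
    show ?thesis
      using circ_circ[OF True assms, of \<psi> \<xi>] circ_circ[OF _ assms, of us p r q \<xi> \<psi>] True
      unfolding associator_def scaleR_fun_apply minus_apply
      by (intro *) (auto simp: mult.commute add_ac minus_one_power_iff)
  next
    case False
    then show ?thesis using 0[of q r] 0[of r q] by simp
  qed
qed

section \<open>The graded Jacobi identity\<close>

text \<open>The inner bracket has degree \<open>q + r - 1\<close>, so the sign of the outer commutator has the exponent
  \<open>(p + 1) (q + r)\<close>. If \<open>q = r = 0\<close>, the subtraction is truncated, but then the inner bracket is \<open>0\<close>.\<close>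

lemma bracket_bracket_eq_circ:
  assumes "homogeneous p \<phi>" "multilinear \<phi>" "homogeneous q \<psi>" "multilinear \<psi>"
    and "homogeneous r \<xi>" "multilinear \<xi>" "multilinear (bracket \<psi> \<xi>)"
  shows "bracket \<phi> (bracket \<psi> \<xi>) =
    circ p (q + r - 1) \<phi> (circ q r \<psi> \<xi>)
    - (-1) ^ ((q + 1) * (r + 1)) *\<^sub>R circ p (r + q - 1) \<phi> (circ r q \<xi> \<psi>)
    - (-1) ^ ((p + 1) * (q + r)) *\<^sub>R circ (q + r - 1) p (circ q r \<psi> \<xi>) \<phi>
    + (-1) ^ ((p + 1) * (q + r) + (q + 1) * (r + 1)) *\<^sub>R
        circ (r + q - 1) p (circ r q \<xi> \<psi>) \<phi>"
proof -
  note eq = bracket_eq_circ[OF assms(3-6)]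
  have "homogeneous (q + r - 1) (bracket \<psi> \<xi>)"
    using homogeneous_circ[of q r \<psi> \<xi>] homogeneous_circ[of r q \<xi> \<psi>]
    unfolding eq homogeneous_def by (simp add: add.commute)
  then have 1: "bracket \<phi> (bracket \<psi> \<xi>) = circ p (q + r - 1) \<phi> (bracket \<psi> \<xi>)
      - (-1) ^ ((p + 1) * (q + r - 1 + 1)) *\<^sub>R circ (q + r - 1) p (bracket \<psi> \<xi>) \<phi>"
    using assms by (intro bracket_eq_circ)
  have 2: "(-1::real) ^ ((p + 1) * (q + r - 1 + 1)) *\<^sub>R circ (q + r - 1) p (bracket \<psi> \<xi>) \<phi>
      = (-1) ^ ((p + 1) * (q + r)) *\<^sub>R circ (q + r - 1) p (bracket \<psi> \<xi>) \<phi>"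
  proof (cases "q + r = 0")
    case True
    then have "bracket \<psi> \<xi> = 0" unfolding eq by (auto simp: circ_def)
    then show ?thesis by (simp add: linear_0[OF linear_circ_left])
  qed simp
  show ?thesis
    unfolding 1 2 unfolding eq linear_diff[OF linear_circ_right[OF assms(2)]]
      linear_scale[OF linear_circ_right[OF assms(2)]] linear_diff[OF linear_circ_left]
      linear_scale[OF linear_circ_left]
    by (simp add: scaleR_diff_right power_add algebra_simps)
qed

text \<open>The passage from a graded pre-Lie product to a graded Lie bracket, reduced to the signs
  \<open>\<alpha>, \<beta>, \<gamma>\<close> of the pairs \<open>\<phi>\<psi>, \<psi>\<xi>, \<phi>\<xi>\<close>. Here \<open>l\<^sub>1, \<dots>, l\<^sub>6\<close> are the products bracketed to the left and
  \<open>r\<^sub>1, \<dots>, r\<^sub>6\<close> those bracketed to the right, in the orders \<open>\<phi>\<psi>\<xi>, \<phi>\<xi>\<psi>, \<psi>\<xi>\<phi>, \<psi>\<phi>\<xi>, \<xi>\<phi>\<psi>, \<xi>\<psi>\<phi>\<close>.\<close>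

lemma jacobi_of_associators:
  fixes \<alpha> \<beta> \<gamma> :: real and l\<^sub>1 l\<^sub>2 l\<^sub>3 l\<^sub>4 l\<^sub>5 l\<^sub>6 :: "'a::real_vector"
  assumes "\<alpha> = 1 \<or> \<alpha> = -1" "\<beta> = 1 \<or> \<beta> = -1" "\<gamma> = 1 \<or> \<gamma> = -1"
    and "l\<^sub>1 - r\<^sub>1 = \<beta> *\<^sub>R (l\<^sub>2 - r\<^sub>2)" "l\<^sub>3 - r\<^sub>3 = \<gamma> *\<^sub>R (l\<^sub>4 - r\<^sub>4)" "l\<^sub>5 - r\<^sub>5 = \<alpha> *\<^sub>R (l\<^sub>6 - r\<^sub>6)"
  shows "\<gamma> *\<^sub>R (r\<^sub>1 - \<beta> *\<^sub>R r\<^sub>2 - (\<alpha> * \<gamma>) *\<^sub>R l\<^sub>3 + (\<alpha> * \<gamma> * \<beta>) *\<^sub>R l\<^sub>6)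
    + \<alpha> *\<^sub>R (r\<^sub>3 - \<gamma> *\<^sub>R r\<^sub>4 - (\<beta> * \<alpha>) *\<^sub>R l\<^sub>5 + (\<beta> * \<alpha> * \<gamma>) *\<^sub>R l\<^sub>2)
    + \<beta> *\<^sub>R (r\<^sub>5 - \<alpha> *\<^sub>R r\<^sub>6 - (\<gamma> * \<beta>) *\<^sub>R l\<^sub>1 + (\<gamma> * \<beta> * \<alpha>) *\<^sub>R l\<^sub>4) = 0"
proof -
  have l: "l\<^sub>1 = r\<^sub>1 + \<beta> *\<^sub>R (l\<^sub>2 - r\<^sub>2)" "l\<^sub>3 = r\<^sub>3 + \<gamma> *\<^sub>R (l\<^sub>4 - r\<^sub>4)" "l\<^sub>5 = r\<^sub>5 + \<alpha> *\<^sub>R (l\<^sub>6 - r\<^sub>6)"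
    using assms(4-6) by (simp_all add: algebra_simps)
  show ?thesis unfolding l using assms(1-3) by (elim disjE) (simp_all add: algebra_simps)
qed

lemma bracket_graded_jacobi:
  assumes "homogeneous p \<phi>" "multilinear \<phi>" "homogeneous q \<psi>" "multilinear \<psi>"
    and "homogeneous r \<xi>" "multilinear \<xi>"
    and "multilinear (bracket \<psi> \<xi>)" "multilinear (bracket \<xi> \<phi>)" "multilinear (bracket \<phi> \<psi>)"
  shows "(-1) ^ ((p + 1) * (r + 1)) *\<^sub>R bracket \<phi> (bracket \<psi> \<xi>)
    + (-1) ^ ((q + 1) * (p + 1)) *\<^sub>R bracket \<psi> (bracket \<xi> \<phi>)
    + (-1) ^ ((r + 1) * (q + 1)) *\<^sub>R bracket \<xi> (bracket \<phi> \<psi>) = 0"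
proof -
  define \<alpha> \<beta> \<gamma> :: real where "\<alpha> = (-1) ^ ((p + 1) * (q + 1))"
    and "\<beta> = (-1) ^ ((q + 1) * (r + 1))" and "\<gamma> = (-1) ^ ((p + 1) * (r + 1))"
  have sgn: "\<alpha> = 1 \<or> \<alpha> = -1" "\<beta> = 1 \<or> \<beta> = -1" "\<gamma> = 1 \<or> \<gamma> = -1"
    by (simp_all add: \<alpha>_def \<beta>_def \<gamma>_def minus_one_power_iff)
  have s: "(-1::real) ^ ((p + 1) * (q + r)) = \<alpha> * \<gamma>" "(-1::real) ^ ((q + 1) * (r + p)) = \<beta> * \<alpha>"
    "(-1::real) ^ ((r + 1) * (p + q)) = \<gamma> * \<beta>"
    "(-1::real) ^ ((q + 1) * (p + 1)) = \<alpha>" "(-1::real) ^ ((r + 1) * (q + 1)) = \<beta>"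
    "(-1::real) ^ ((r + 1) * (p + 1)) = \<gamma>"
    by (auto simp: \<alpha>_def \<beta>_def \<gamma>_def minus_one_power_iff)
  note d = \<alpha>_def[symmetric] \<beta>_def[symmetric] \<gamma>_def[symmetric] s
  note b = bracket_bracket_eq_circ[OF assms(1-6,7), unfolded power_add, unfolded d]
    bracket_bracket_eq_circ[OF assms(3-6,1-2,8), unfolded power_add, unfolded d]
    bracket_bracket_eq_circ[OF assms(5-6,1-4,9), unfolded power_add, unfolded d]
  note a = associator_symmetric[OF assms(2), of p q r \<psi> \<xi>, unfolded associator_def d]
    associator_symmetric[OF assms(4), of q r p \<xi> \<phi>, unfolded associator_def d]
    associator_symmetric[OF assms(6), of r p q \<phi> \<psi>, unfolded associator_def d]
  show ?thesis
    unfolding d b by (rule jacobi_of_associators[OF sgn a])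
qed

section \<open>Derivatives of polynomials\<close>

lemma poly_mapping_add_induct [case_names zero single add]:
  fixes u :: "'a \<Rightarrow>\<^sub>0 'b::comm_monoid_add"
  assumes "P 0" "\<And>k c. P (Poly_Mapping.single k c)" "\<And>u v. P u \<Longrightarrow> P v \<Longrightarrow> P (u + v)"
  shows "P u"
proof -
  have "u = (\<Sum>k\<in>Poly_Mapping.keys u. Poly_Mapping.single k (Poly_Mapping.lookup u k))"
    by (intro poly_mapping_eqI) (auto simp: lookup_sum lookup_single when_def in_keys_iff)
  moreover have "P (\<Sum>k\<in>A. Poly_Mapping.single k (f k))" for A and f :: "'a \<Rightarrow> 'b"
    by (induction A rule: infinite_finite_induct) (auto intro: assms)
  ultimately show ?thesis by metis
qed

lemma scaleR_single: "c *\<^sub>R Poly_Mapping.single k d = Poly_Mapping.single k (c *\<^sub>R d)"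
  by (intro poly_mapping_eqI) (auto simp: scaleR_poly_mapping.rep_eq lookup_single when_def)

text \<open>Scalars act through the constant polynomials, which makes multiplication bilinear over the reals.\<close>

lemma scaleR_eq_times: "c *\<^sub>R u = Poly_Mapping.single 0 c * (u :: 'n::finite polys)"
  by (induction u rule: poly_mapping_add_induct)
    (simp_all add: scaleR_single mult_single scaleR_add_right distrib_left)

lemma scaleR_times_left [simp]: "(c *\<^sub>R u) * v = c *\<^sub>R (u * (v :: 'n::finite polys))"
  by (simp add: scaleR_eq_times mult_ac)

lemma scaleR_times_right [simp]: "u * (c *\<^sub>R v) = c *\<^sub>R (u * (v :: 'n::finite polys))"
  by (simp add: scaleR_eq_times mult_ac)

lemma linear_times_right: "linear (\<lambda>u. v * (u :: 'n::finite polys))"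
  by (intro linearI) (simp_all add: distrib_left)

lemma linear_times_left: "linear (\<lambda>u. (u :: 'n::finite polys) * v)"
  by (intro linearI) (simp_all add: distrib_right)

lemma linear_partial: "linear (partial i)"
  by (intro linearI poly_mapping_eqI)
    (simp_all add: lookup_partial lookup_add scaleR_poly_mapping.rep_eq algebra_simps)

lemma partial_single:
  "partial i (Poly_Mapping.single a c) = Poly_Mapping.single (a - axis i 1) (real (a $ i) * c)"
  by (cases "c = 0") (simp_all add: partial_def x_pow_def scaleR_single)

text \<open>Both sides are bilinear, so it suffices to compare monomials. Truncated subtraction of exponents
  is harmless since \<open>\<partial>\<^sub>i x^a\<close> has the coefficient \<open>a\<^sub>i = 0\<close> wherever truncation occurs.\<close>

lemma partial_times: "partial i (u * v) = partial i u * v + u * partial i v"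
proof (induction u rule: poly_mapping_add_induct)
  case (single a c)
  show ?case
  proof (induction v rule: poly_mapping_add_induct)
    case (single b d)
    have "a + b - axis i 1 = a - axis i 1 + b" if "a $ i \<noteq> 0"
      using that by (auto simp: vec_eq_iff axis_def)
    moreover have "a + b - axis i 1 = a + (b - axis i 1)" if "b $ i \<noteq> 0"
      using that by (auto simp: vec_eq_iff axis_def)
    ultimately show ?case
      by (cases "a $ i = 0"; cases "b $ i = 0")
        (simp_all add: mult_single partial_single single_add[symmetric] algebra_simps)
  qed (simp_all add: linear_0[OF linear_partial] linear_add[OF linear_partial] distrib_left add_ac)
qed (simp_all add: linear_0[OF linear_partial] linear_add[OF linear_partial] distrib_right add_ac)

lemma partial_x_pow: "partial i (x_pow a) = real (a $ i) *\<^sub>R x_pow (a - axis i 1)"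
  by (simp add: x_pow_def partial_single scaleR_single)

lemma x_pow_add: "x_pow (a + b) = x_pow a * x_pow b"
  by (simp add: x_pow_def mult_single)

lemma multiindex_induct [case_names zero step]:
  fixes a :: "nat ^ 'n::finite"
  assumes "P 0" "\<And>a i. P a \<Longrightarrow> P (a + axis i 1)"
  shows "P a"
proof (induction "\<Sum>i\<in>UNIV. a $ i" arbitrary: a)
  case 0
  then have "a = 0" by (auto simp: vec_eq_iff)
  with assms show ?case by simp
next
  case (Suc n)
  then obtain i where i: "a $ i \<noteq> 0" by (metis sum.neutral nat.distinct(1))
  have a: "a = (a - axis i 1) + axis i 1"
    using i by (auto simp: vec_eq_iff axis_def)
  have "(\<Sum>j\<in>UNIV. a $ j) = (\<Sum>j\<in>UNIV. (a - axis i 1) $ j) + 1"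
    by (subst a) (simp add: sum.distrib axis_def)
  with Suc.hyps have "P (a - axis i 1)" by simp
  then show ?case using assms(2) a by metis
qed

lemma partials_zero [simp]: "partials 0 u = u"
proof -
  have "Finite_Set.fold (\<lambda>i. partial i ^^ ((0::nat^'a) $ i)) u A = u" if "finite A" for A
    using that
  proof (induction A)
    case (insert x A)
    interpret comp_fun_commute "\<lambda>i. partial i ^^ ((0::nat^'a) $ i)"
      by (rule comp_fun_commute_partial)
    from fold_insert[OF insert(1,2), of u] insert(3) show ?case by (simp add: id_def)
  qed simp
  then show ?thesis by (simp add: partials_def)
qed

text \<open>In the fold that defines the iterated derivative, the variable \<open>i\<close> can be taken last.\<close>

lemma partials_step: "partials (a + axis i 1) u = partial i (partials a u)"
proof -
  let ?f = "\<lambda>b j. partial j ^^ (b $ j)"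
  have eq: "Finite_Set.fold (?f (a + axis i 1)) u (UNIV - {i}) = Finite_Set.fold (?f a) u (UNIV - {i})"
    by (rule Finite_Set.fold_cong[OF comp_fun_commute_partial[unfolded comp_fun_commute_def']
          comp_fun_commute_partial[unfolded comp_fun_commute_def']])
      (auto simp: axis_def)
  have split: "partials b u = ?f b i (Finite_Set.fold (?f b) u (UNIV - {i}))" for b :: "nat ^ 'a"
  proof -
    interpret comp_fun_commute "?f b" by (rule comp_fun_commute_partial)
    show ?thesis unfolding partials_def using fold_rec[of UNIV i u] by simp
  qed
  show ?thesis unfolding split eq by simp
qed

lemma linear_partials: "linear (partials a)"
proof (induction a rule: multiindex_induct)
  case zero
  have "partials 0 = (\<lambda>u. u)" by auto
  then show ?case by (simp add: linear_id[unfolded id_def])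
next
  case (step a i)
  have "partials (a + axis i 1) = partial i \<circ> partials a" by (simp add: fun_eq_iff partials_step del: One_nat_def)
  then show ?case unfolding \<open>partials (a + axis i 1) = _\<close> using step linear_partial linear_compose by blast
qed

section \<open>Polydifferential operators by degree and weight\<close>

definition multiindex_int :: "nat ^ 'n \<Rightarrow> int ^ 'n::finite"
  where "multiindex_int a = (\<chi> i. int (a $ i))"

definition weight :: "nat ^ 'n \<Rightarrow> (nat ^ 'n) list \<Rightarrow> int ^ 'n::finite"
  where "weight a as = multiindex_int a - sum_list (map multiindex_int as)"

text \<open>The weights are restricted to an arbitrary set: singletons serve to track weights, and the set
  of all weights gives the full space of cochains of a degree.\<close>

definition cochains_deg_over :: "(int ^ 'n) set \<Rightarrow> nat \<Rightarrow> 'n::finite multiop set"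
  where "cochains_deg_over \<Gamma> p = span {monop a as | a as. length as = p \<and> weight a as \<in> \<Gamma>}"

lemma multiindex_int_add: "multiindex_int (a + b) = multiindex_int a + multiindex_int b"
  by (simp add: multiindex_int_def vec_eq_iff)

lemma multiindex_int_zero [simp]: "multiindex_int 0 = 0"
  by (simp add: multiindex_int_def vec_eq_iff)

lemma multiindex_int_minus_axis:
  "a $ i \<noteq> 0 \<Longrightarrow> multiindex_int (a - axis i 1) = multiindex_int a - multiindex_int (axis i 1)"
  by (auto simp: multiindex_int_def vec_eq_iff axis_def)

lemma weight_nth: "weight a as $ i = int (a $ i) - (\<Sum>s<length as. int ((as ! s) $ i))"
proof -
  have "sum_list (map multiindex_int as) $ i = (\<Sum>s<length as. int ((as ! s) $ i))"
    by (induction as) (simp_all del: sum.lessThan_Suc add: sum.lessThan_Suc_shift multiindex_int_def)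
  then show ?thesis by (simp add: weight_def multiindex_int_def)
qed

lemma monop_eq_prod_list:
  "monop a as us = (if length us = length as then x_pow a * prod_list (map2 partials as us) else 0)"
  by (auto simp: monop_def prod.list_conv_set_nth atLeast0LessThan intro!: arg_cong2[of _ _ _ _ "(*)"] prod.cong)

lemma monop_in_cochains_deg_over:
  "weight a as \<in> \<Gamma> \<Longrightarrow> monop a as \<in> cochains_deg_over \<Gamma> (length as)"
  unfolding cochains_deg_over_def by (intro span_base) blast

lemma cochains_deg_over_mono: "\<Gamma> \<subseteq> \<Gamma>' \<Longrightarrow> cochains_deg_over \<Gamma> p \<subseteq> cochains_deg_over \<Gamma>' p"
  unfolding cochains_deg_over_def by (intro span_mono) blast

lemma subspace_cochains_deg_over: "subspace (cochains_deg_over \<Gamma> p)"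
  by (simp add: cochains_deg_over_def)

lemma cochains_deg_over_induct [consumes 1, case_names subspace monop]:
  assumes "\<phi> \<in> cochains_deg_over \<Gamma> p" "subspace {\<phi>. P \<phi>}"
    and "\<And>a as. length as = p \<Longrightarrow> weight a as \<in> \<Gamma> \<Longrightarrow> P (monop a as)"
  shows "P \<phi>"
  using assms(1) unfolding cochains_deg_over_def
  by (rule span_induct) (use assms in auto)

lemma homogeneous_monop: "homogeneous (length as) (monop a as)"
  by (simp add: homogeneous_def monop_def)

lemma homogeneous_cochains_deg_over: "\<phi> \<in> cochains_deg_over \<Gamma> p \<Longrightarrow> homogeneous p \<phi>"
  by (induction rule: cochains_deg_over_induct)
    (auto intro: subspace_homogeneous simp: homogeneous_monop)

lemma multilinear_monop: "multilinear (monop a as)"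
  unfolding multilinear_def
proof (intro allI)
  fix xs zs :: "'a polys list"
  show "linear (\<lambda>u. monop a as (xs @ [u] @ zs))"
  proof (cases "length as = length xs + (1 + length zs)")
    case True
    then obtain bs cs ds where as: "as = bs @ cs @ ds"
      and l: "length bs = length xs" "length cs = 1" "length ds = length zs"
      by (metis split_at_lengths add.assoc)
    then obtain c where c: "cs = [c]" by (auto simp: length_Suc_conv)
    have "(\<lambda>u. monop a as (xs @ [u] @ zs))
        = (\<lambda>u. (x_pow a * prod_list (map2 partials bs xs)) * u) \<circ>
          ((\<lambda>u. u * prod_list (map2 partials ds zs)) \<circ> partials c)"
      using l by (auto simp: monop_eq_prod_list as c mult_ac)
    then show ?thesis
      using linear_compose[OF linear_compose[OF linear_partials linear_times_left] linear_times_right]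
      by metis
  next
    case False
    then have "(\<lambda>u. monop a as (xs @ [u] @ zs)) = (\<lambda>u. 0)" by (auto simp: monop_def)
    then show ?thesis by (simp add: linear_zero)
  qed
qed

lemma multilinear_cochains_deg_over: "\<phi> \<in> cochains_deg_over \<Gamma> p \<Longrightarrow> multilinear \<phi>"
  by (induction rule: cochains_deg_over_induct) (auto intro: subspace_multilinear multilinear_monop)

text \<open>The Leibniz rule: \<open>\<partial>\<^sub>i\<close> hits the coefficient or one of the factors.\<close>

lemma partial_monop:
  "partial i (monop a as us) = real (a $ i) *\<^sub>R monop (a - axis i 1) as us
    + (\<Sum>l<length as. monop a (as[l := as ! l + axis i 1]) us)"
proof (cases "length us = length as")
  case True
  then have "partial i (prod_list (map2 partials as us))
      = (\<Sum>l<length as. prod_list (map2 partials (as[l := as ! l + axis i 1]) us))"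
  proof (induction us as rule: list_induct2)
    case Nil
    show ?case using partial_x_pow[of i 0] by (simp add: x_pow_def)
  next
    case (Cons u us b bs)
    then show ?case
      by (simp del: sum.lessThan_Suc One_nat_def add: sum.lessThan_Suc_shift partial_times
          partials_step sum_distrib_left)
  qed
  with True show ?thesis
    by (simp add: monop_eq_prod_list partial_times partial_x_pow sum_distrib_left)
next
  case False
  then show ?thesis by (simp add: monop_def linear_0[OF linear_partial])
qed

lemma sum_list_map_update:
  fixes f :: "'a \<Rightarrow> 'b::ab_group_add"
  assumes "l < length as"
  shows "sum_list (map f (as[l := b])) = sum_list (map f as) - f (as ! l) + f b"
  using assms by (induction as arbitrary: l) (auto split: nat.split simp: algebra_simps)

text \<open>Every term of the Leibniz rule loses \<open>e\<^sub>i\<close>: the exponent of the coefficient drops, or a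
  derivative, which counts negatively, is added.\<close>

lemma partial_cochains_deg_over:
  assumes "\<phi> \<in> cochains_deg_over {w} p"
  shows "(\<lambda>us. partial i (\<phi> us)) \<in> cochains_deg_over {w - multiindex_int (axis i 1)} p"
  using assms
proof (induction rule: cochains_deg_over_induct)
  case subspace
  have "linear (\<lambda>\<phi> us. partial i (\<phi> us :: 'a polys))"
    by (intro linearI ext) (simp_all add: linear_add[OF linear_partial] linear_scale[OF linear_partial])
  then show ?case
    using linear_subspace_vimage[OF _ subspace_cochains_deg_over] by (simp add: vimage_def)
next
  case (monop a as)
  let ?w = "w - multiindex_int (axis i 1)"
  have "(\<lambda>us. partial i (monop a as us)) = real (a $ i) *\<^sub>R monop (a - axis i 1) as
    + (\<Sum>l<length as. monop a (as[l := as ! l + axis i 1]))"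
    by (auto simp: partial_monop sum_fun_apply)
  also have "\<dots> \<in> cochains_deg_over {?w} p"
  proof (intro subspace_add[OF subspace_cochains_deg_over] subspace_sum[OF subspace_cochains_deg_over])
    show "real (a $ i) *\<^sub>R monop (a - axis i 1) as \<in> cochains_deg_over {?w} p"
    proof (cases "a $ i = 0")
      case True
      then show ?thesis by (simp add: subspace_0[OF subspace_cochains_deg_over])
    next
      case False
      then have "weight (a - axis i 1) as = ?w"
        using monop by (auto simp: weight_def multiindex_int_minus_axis simp del: One_nat_def)
      then show ?thesis
        using monop monop_in_cochains_deg_over[of "a - axis i 1" as "{?w}"]
        by (intro subspace_scale[OF subspace_cochains_deg_over]) simp
    qed
  next
    fix l assume "l \<in> {..<length as}"
    then have "weight a (as[l := as ! l + axis i 1]) = ?w"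
      using monop by (simp add: weight_def sum_list_map_update multiindex_int_add)
    then show "monop a (as[l := as ! l + axis i 1]) \<in> cochains_deg_over {?w} p"
      using monop_in_cochains_deg_over[of a "as[l := as ! l + axis i 1]" "{?w}"] monop by simp
  qed
  finally show ?case .
qed

lemma partials_cochains_deg_over:
  assumes "\<phi> \<in> cochains_deg_over {w} p"
  shows "(\<lambda>us. partials c (\<phi> us)) \<in> cochains_deg_over {w - multiindex_int c} p"
proof (induction c rule: multiindex_induct)
  case zero
  with assms show ?case by simp
next
  case (step c i)
  then show ?case
    using partial_cochains_deg_over[OF step, of i]
    by (simp add: partials_step multiindex_int_add diff_diff_add del: One_nat_def)
qed

text \<open>What remains of a monomial operator when the derivative in one of its slots is stripped off:
  \<open>x^a\<close>, the derivatives \<open>as\<close> before and \<open>bs\<close> after the slot.\<close>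

definition place_between :: "nat ^ 'n \<Rightarrow> (nat ^ 'n) list \<Rightarrow> (nat ^ 'n) list \<Rightarrow> nat \<Rightarrow> 'n::finite multiop \<Rightarrow> 'n multiop"
  where "place_between a as bs q \<psi> us = (if length us = length as + q + length bs
    then monop a as (take (length as) us) * \<psi> (take q (drop (length as) us))
      * monop 0 bs (drop (length as + q) us) else 0)"

lemma place_between_cochains_deg_over:
  assumes "\<psi> \<in> cochains_deg_over {w} q"
  shows "place_between a as bs q \<psi>
    \<in> cochains_deg_over {weight a (as @ bs) + w} (length as + q + length bs)"
  using assms
proof (induction rule: cochains_deg_over_induct)
  case subspace
  have "linear (place_between a as bs q)"
    by (intro linearI ext) (auto simp: place_between_def algebra_simps)
  then show ?case
    using linear_subspace_vimage[OF _ subspace_cochains_deg_over] by (simp add: vimage_def)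
next
  case (monop c cs)
  have "place_between a as bs q (monop c cs) us = monop (a + c) (as @ cs @ bs) us" for us
  proof (cases "length us = length as + q + length bs")
    case True
    then obtain xs ys zs where "us = xs @ ys @ zs"
      "length xs = length as" "length ys = q" "length zs = length bs"
      by (rule split_at_lengths)
    with monop show ?thesis
      by (simp add: place_between_def monop_eq_prod_list x_pow_add x_pow_def[of 0] mult_ac)
  next
    case False
    with monop show ?thesis by (auto simp: place_between_def monop_def)
  qed
  then have "place_between a as bs q (monop c cs) = monop (a + c) (as @ cs @ bs)" by blast
  moreover have "weight (a + c) (as @ cs @ bs) = weight a (as @ bs) + w"
    using monop by (auto simp: weight_def multiindex_int_add)
  ultimately show ?case
    using monop monop_in_cochains_deg_over[of "a + c" "as @ cs @ bs"] by (simp add: add.assoc)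
qed

text \<open>Inserting \<open>\<psi>\<close> into slot \<open>i\<close> of a monomial operator composes \<open>\<psi>\<close> with the derivative \<open>as ! i\<close>,
  which lowers the weight of \<open>\<psi>\<close> by exactly the amount by which the other factors of the monomial
  exceed its weight.\<close>

lemma circ_monop_left:
  assumes "\<psi> \<in> cochains_deg_over {v} q"
  shows "circ (length as) q (monop a as) \<psi> \<in> cochains_deg_over {weight a as + v} (length as + q - 1)"
proof -
  have "circ (length as) q (monop a as) \<psi> = (\<Sum>i<length as. (-1) ^ (i * (q + 1)) *\<^sub>R
      place_between a (take i as) (drop (Suc i) as) q (\<lambda>us. partials (as ! i) (\<psi> us)))"
  proof
    fix us
    show "circ (length as) q (monop a as) \<psi> us = (\<Sum>i<length as. (-1) ^ (i * (q + 1)) *\<^sub>R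
      place_between a (take i as) (drop (Suc i) as) q (\<lambda>us. partials (as ! i) (\<psi> us))) us"
    proof (cases "length us + 1 = length as + q")
      case len: True
      have "monop a as (take i us @ [\<psi> (take q (drop i us))] @ drop (i + q) us)
        = place_between a (take i as) (drop (Suc i) as) q (\<lambda>us. partials (as ! i) (\<psi> us)) us"
        if "i < length as" for i
      proof -
        have "length us = i + q + (length as - Suc i)" using that len by simp
        then obtain xs ys zs where us: "us = xs @ ys @ zs"
          "length xs = i" "length ys = q" "length zs = length as - Suc i"
          by (rule split_at_lengths)
        have "length as = i + 1 + (length as - Suc i)" using that by simp
        then obtain bs b cs where as: "as = bs @ b @ cs"
          "length bs = i" "length b = 1" "length cs = length as - Suc i"
          by (rule split_at_lengths)
        from as(3) obtain c where c: "b = [c]" by (auto simp: length_Suc_conv)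
        have "length cs = length zs" using us(4) as(4) by argo
        then show ?thesis
          using us(1-3) as(1,2) c
          by (simp add: nth_append place_between_def monop_eq_prod_list x_pow_def[of 0] mult_ac)
      qed
      then show ?thesis using len by (simp add: circ_def sum_fun_apply)
    next
      case False
      then show ?thesis by (auto simp: circ_def sum_fun_apply place_between_def intro!: sum.neutral)
    qed
  qed
  also have "\<dots> \<in> cochains_deg_over {weight a as + v} (length as + q - 1)"
  proof (intro subspace_sum[OF subspace_cochains_deg_over] subspace_scale[OF subspace_cochains_deg_over])
    fix i assume i: "i \<in> {..<length as}"
    then have as: "as = take i as @ as ! i # drop (Suc i) as"
      by (simp add: id_take_nth_drop)
    have "weight a as = weight a (take i as @ drop (Suc i) as) - multiindex_int (as ! i)"
      using arg_cong[OF as, of "weight a"] by (simp add: weight_def)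
    then have "weight a (take i as @ drop (Suc i) as) + (v - multiindex_int (as ! i)) = weight a as + v"
      by simp
    moreover have "length (take i as) + q + length (drop (Suc i) as) = length as + q - 1"
      using i by simp
    ultimately show "place_between a (take i as) (drop (Suc i) as) q (\<lambda>us. partials (as ! i) (\<psi> us))
        \<in> cochains_deg_over {weight a as + v} (length as + q - 1)"
      using place_between_cochains_deg_over[OF partials_cochains_deg_over[OF assms]] by metis
  qed
  finally show ?thesis .
qed

lemma circ_cochains_deg_over:
  assumes "\<phi> \<in> cochains_deg_over \<Gamma> p" "\<psi> \<in> cochains_deg_over \<Gamma>' q"
    and add: "\<And>a b. a \<in> \<Gamma> \<Longrightarrow> b \<in> \<Gamma>' \<Longrightarrow> a + b \<in> \<Gamma>''"
  shows "circ p q \<phi> \<psi> \<in> cochains_deg_over \<Gamma>'' (p + q - 1)"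
  using assms(1)
proof (induction rule: cochains_deg_over_induct)
  case subspace
  show ?case
    using linear_subspace_vimage[OF linear_circ_left subspace_cochains_deg_over]
    by (simp add: vimage_def)
next
  case (monop a as)
  show ?case
    using assms(2)
  proof (induction rule: cochains_deg_over_induct)
    case subspace
    show ?case
      using linear_subspace_vimage[OF linear_circ_right[OF multilinear_monop] subspace_cochains_deg_over]
      by (simp add: vimage_def)
  next
    case (monop b bs)
    have "monop b bs \<in> cochains_deg_over {weight b bs} q"
      using monop monop_in_cochains_deg_over[of b bs] by auto
    from circ_monop_left[OF this, of as a] show ?case
      using cochains_deg_over_mono[of "{weight a as + weight b bs}" \<Gamma>''] add
        \<open>length as = p\<close> \<open>weight a as \<in> \<Gamma>\<close> \<open>weight b bs \<in> \<Gamma>'\<close> by blast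
  qed
qed

lemma bracket_cochains_deg_over:
  assumes "\<phi> \<in> cochains_deg_over \<Gamma> p" "\<psi> \<in> cochains_deg_over \<Gamma>' q"
    and add: "\<And>a b. a \<in> \<Gamma> \<Longrightarrow> b \<in> \<Gamma>' \<Longrightarrow> a + b \<in> \<Gamma>''"
  shows "bracket \<phi> \<psi> \<in> cochains_deg_over \<Gamma>'' (p + q - 1)"
proof -
  have "circ q p \<psi> \<phi> \<in> cochains_deg_over \<Gamma>'' (q + p - 1)"
    using assms(2,1) by (rule circ_cochains_deg_over) (subst add.commute, rule add)
  then have "circ q p \<psi> \<phi> \<in> cochains_deg_over \<Gamma>'' (p + q - 1)"
    by (simp only: add.commute)
  then show ?thesis
    unfolding bracket_eq_circ[OF homogeneous_cochains_deg_over[OF assms(1)]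
        multilinear_cochains_deg_over[OF assms(1)] homogeneous_cochains_deg_over[OF assms(2)]
        multilinear_cochains_deg_over[OF assms(2)]]
    by (intro subspace_diff[OF subspace_cochains_deg_over] subspace_scale[OF subspace_cochains_deg_over]
        circ_cochains_deg_over[OF assms])
qed

section \<open>The cup product\<close>

lemma linear_cup_left: "linear (\<lambda>\<phi>. cup \<phi> \<psi>)"
  by (intro linearI ext) (simp_all add: cup_def sum.distrib distrib_right scaleR_sum_right)

lemma linear_cup_right: "linear (cup \<phi>)"
  by (intro linearI ext) (simp_all add: cup_def sum.distrib distrib_left scaleR_sum_right)

text \<open>Both sides sum over all ways to cut the argument list into three pieces.\<close>

lemma cup_assoc:
  fixes \<phi> \<psi> \<xi> :: "'n::finite multiop"
  shows "cup (cup \<phi> \<psi>) \<xi> = cup \<phi> (cup \<psi> \<xi>)"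
proof
  fix us :: "'n polys list"
  let ?n = "length us"
  let ?f = "\<lambda>k m. \<phi> (take k us) * \<psi> (take m (drop k us)) * \<xi> (drop (k + m) us)"
  have "cup (cup \<phi> \<psi>) \<xi> us = (\<Sum>p\<le>?n. \<Sum>k\<le>p. ?f k (p - k))"
    unfolding cup_def by (intro sum.cong refl) (auto simp: sum_distrib_right drop_take min_def intro!: sum.cong)
  also have "\<dots> = (\<Sum>(k, m)\<in>{(k, m). k + m \<le> ?n}. ?f k m)"
    by (rule sum.triangle_reindex_eq[symmetric])
  also have "{(k, m). k + m \<le> ?n} = Sigma {..?n} (\<lambda>k. {..?n - k})"
    by auto
  also have "(\<Sum>(k, m)\<in>Sigma {..?n} (\<lambda>k. {..?n - k}). ?f k m) = (\<Sum>k\<le>?n. \<Sum>m\<le>?n - k. ?f k m)"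
    by (rule sum.Sigma[symmetric]) auto
  also have "\<dots> = cup \<phi> (cup \<psi> \<xi>) us"
    unfolding cup_def by (intro sum.cong refl) (auto simp: sum_distrib_left mult.assoc add.commute)
  finally show "cup (cup \<phi> \<psi>) \<xi> us = cup \<phi> (cup \<psi> \<xi>) us" .
qed

lemma cup_monop: "cup (monop a as) (monop b bs) = monop (a + b) (as @ bs)"
proof
  fix us
  have eq: "cup (monop a as) (monop b bs) us = (if length us = length as + length bs
      then monop a as (take (length as) us) * monop b bs (drop (length as) us) else 0)"
    by (rule cup_homogeneous) (simp_all add: monop_def)
  show "cup (monop a as) (monop b bs) us = monop (a + b) (as @ bs) us"
  proof (cases "length us = length as + length bs")
    case True
    then obtain xs ys where "us = xs @ ys" "length xs = length as" "length ys = length bs"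
      by (rule split_at_length)
    then show ?thesis unfolding eq by (simp add: monop_eq_prod_list x_pow_add mult_ac)
  next
    case False
    then show ?thesis unfolding eq by (simp add: monop_def)
  qed
qed

lemma cup_cochains_deg_over:
  assumes "\<phi> \<in> cochains_deg_over \<Gamma> p" "\<psi> \<in> cochains_deg_over \<Gamma>' q"
    and add: "\<And>a b. a \<in> \<Gamma> \<Longrightarrow> b \<in> \<Gamma>' \<Longrightarrow> a + b \<in> \<Gamma>''"
  shows "cup \<phi> \<psi> \<in> cochains_deg_over \<Gamma>'' (p + q)"
  using assms(1)
proof (induction rule: cochains_deg_over_induct)
  case subspace
  show ?case
    using linear_subspace_vimage[OF linear_cup_left subspace_cochains_deg_over]
    by (simp add: vimage_def)
next
  case (monop a as)
  show ?case
    using assms(2)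
  proof (induction rule: cochains_deg_over_induct)
    case subspace
    show ?case
      using linear_subspace_vimage[OF linear_cup_right subspace_cochains_deg_over]
      by (simp add: vimage_def)
  next
    case (monop b bs)
    have "weight (a + b) (as @ bs) = weight a as + weight b bs"
      by (simp add: weight_def multiindex_int_add)
    then have "weight (a + b) (as @ bs) \<in> \<Gamma>''"
      using add \<open>weight a as \<in> \<Gamma>\<close> \<open>weight b bs \<in> \<Gamma>'\<close> by simp
    then show ?case
      using monop_in_cochains_deg_over[of "a + b" "as @ bs" \<Gamma>''] \<open>length as = p\<close> \<open>length bs = q\<close>
      by (simp add: cup_monop)
  qed
qed

section \<open>The Hochschild differential as a bracket with the multiplication\<close>

lemma minus_one_power_times: "(-1) ^ k * u = (-1) ^ k *\<^sub>R (u :: 'n::finite polys)"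
  by (simp add: minus_one_power_iff)

lemma linear_hochschild: "linear hochschild"
  by (intro linearI ext)
    (simp_all add: hochschild_def Let_def minus_one_power_times distrib_left distrib_right
      sum.distrib scaleR_add_right scaleR_diff_right scaleR_sum_right mult.commute)

abbreviation multiplication :: "'n::finite multiop"
  where "multiplication \<equiv> monop 0 [0, 0]"

lemma multiplication_apply: "multiplication [u, v] = u * v"
  by (simp add: monop_eq_prod_list x_pow_def)

lemma multiplication_in_cochains_deg_over: "multiplication \<in> cochains_deg_over {0} 2"
  using monop_in_cochains_deg_over[of 0 "[0, 0]" "{0}"] by (simp add: weight_def numeral_2_eq_2)

text \<open>Inserting \<open>\<phi>\<close> into the two slots of the multiplication gives the two outer terms of the
  differential, inserting the multiplication into \<open>\<phi>\<close> gives the inner ones.\<close>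

lemma hochschild_eq_bracket:
  assumes "homogeneous p \<phi>" "multilinear \<phi>"
  shows "hochschild \<phi> = (-1) ^ (p + 1) *\<^sub>R bracket multiplication \<phi>"
proof
  fix us
  have "homogeneous 2 (multiplication :: 'a multiop)"
    using multiplication_in_cochains_deg_over homogeneous_cochains_deg_over by blast
  note eq = bracket_eq_circ[OF this multilinear_monop assms]
  show "hochschild \<phi> us = ((-1) ^ (p + 1) *\<^sub>R bracket multiplication \<phi>) us"
  proof (cases "length us = p + 1")
    case False
    then have "bracket multiplication \<phi> us = 0" unfolding eq by (simp add: circ_def)
    moreover have "hochschild \<phi> us = 0" if "us \<noteq> []"
    proof -
      have z: "\<phi> vs = 0" if "Suc (length vs) = length us" for vs
        using that False assms(1) by (auto simp: homogeneous_def)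
      have "\<phi> (take (k - 1) us @ [us ! (k - 1) * us ! k] @ drop (k + 1) us) = 0"
        if "k \<in> {1..length us - 1}" for k
        using that \<open>us \<noteq> []\<close> by (intro z) auto
      moreover have "\<phi> (tl us) = 0" "\<phi> (butlast us) = 0"
        using \<open>us \<noteq> []\<close> by (auto intro!: z simp: Suc_diff_Suc)
      ultimately show ?thesis by (simp add: hochschild_def)
    qed
    ultimately show ?thesis by (auto simp: hochschild_def)
  next
    case True
    then have "us \<noteq> []" by auto
    then obtain vs v where us: "us = vs @ [v]" by (meson rev_exhaust)
    have ends: "take p us = butlast us" "drop p us = [last us]"
      using True by (simp_all add: us)
    obtain u ws where us': "us = u # ws" using \<open>us \<noteq> []\<close> by (meson list.exhaust)
    have starts: "take (Suc 0) us = [hd us]" "take p (drop (Suc 0) us) = tl us" "drop (Suc p) us = []"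
      using True by (simp_all add: us')
    have 1: "circ 2 p multiplication \<phi> us = \<phi> (butlast us) * last us + (-1) ^ (p + 1) *\<^sub>R (hd us * \<phi> (tl us))"
      using True by (simp add: circ_def numeral_2_eq_2 multiplication_apply starts ends)
    have 2: "circ p 2 \<phi> multiplication us =
      - (\<Sum>k=1..p. (-1) ^ k *\<^sub>R \<phi> (take (k - 1) us @ [us ! (k - 1) * us ! k] @ drop (k + 1) us))"
    proof -
      have "take 2 (drop i us) = [us ! i, us ! (i + 1)]" if "i < p" for i
        using that True by (simp add: numeral_2_eq_2 take_Suc_conv_app_nth)
      then have "circ p 2 \<phi> multiplication us =
          (\<Sum>i<p. (-1) ^ i *\<^sub>R \<phi> (take i us @ [us ! i * us ! (i + 1)] @ drop (i + 2) us))"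
        using True by (auto simp: circ_def multiplication_apply minus_one_power_iff intro!: sum.cong)
      also have "\<dots> = (\<Sum>k=1..p. - ((-1) ^ k *\<^sub>R
          \<phi> (take (k - 1) us @ [us ! (k - 1) * us ! k] @ drop (k + 1) us)))"
        by (rule sum.reindex_bij_witness[of _ "\<lambda>k. k - 1" Suc]) auto
      finally show ?thesis by (simp add: sum_negf)
    qed
    have "us \<noteq> []" "length us - 1 = p" using True by auto
    then have "hochschild \<phi> us = hd us * \<phi> (tl us)
       + (\<Sum>k=1..p. (-1) ^ k *\<^sub>R \<phi> (take (k - 1) us @ [us ! (k - 1) * us ! k] @ drop (k + 1) us))
       + (-1) ^ (p + 1) *\<^sub>R (\<phi> (butlast us) * last us)"
      unfolding hochschild_def Let_def minus_one_power_times by (simp only: if_False)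
    then show ?thesis
      by (simp only: eq scaleR_fun_apply minus_apply 1 2) (simp add: minus_one_power_iff)
  qed
qed

lemma hochschild_cochains_deg_over:
  assumes "\<phi> \<in> cochains_deg_over \<Gamma> p"
  shows "hochschild \<phi> \<in> cochains_deg_over \<Gamma> (p + 1)"
  using bracket_cochains_deg_over[OF multiplication_in_cochains_deg_over assms, of \<Gamma>]
  unfolding hochschild_eq_bracket[OF homogeneous_cochains_deg_over[OF assms]
      multilinear_cochains_deg_over[OF assms]]
  by (intro subspace_scale[OF subspace_cochains_deg_over]) simp

text \<open>Both halves of the bracket agree, and each is the associator
  \<open>(u v) w - u (v w)\<close> of the polynomial algebra.\<close>

lemma bracket_multiplication_multiplication:
  "bracket multiplication (multiplication :: 'n::finite multiop) = 0"
proof -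
  have "homogeneous 2 (multiplication :: 'n multiop)"
    using multiplication_in_cochains_deg_over homogeneous_cochains_deg_over by blast
  moreover have "circ 2 2 multiplication multiplication = (0 :: 'n multiop)"
  proof
    fix us :: "'n polys list"
    show "circ 2 2 multiplication multiplication us = (0 :: 'n multiop) us"
      by (cases "length us = 3")
        (auto simp: circ_def numeral_3_eq_3 numeral_2_eq_2 length_Suc_conv multiplication_apply mult.assoc)
  qed
  ultimately show ?thesis
    using bracket_eq_circ[OF _ multilinear_monop _ multilinear_monop] by fastforce
qed

text \<open>By antisymmetry two of the terms of the Jacobi identity for \<open>\<mu>, \<mu>, \<phi>\<close> coincide, and the third
  one contains \<open>[\<mu>, \<mu>] = 0\<close>.\<close>

lemma hochschild_hochschild_deg:
  fixes \<phi> :: "'n::finite multiop"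
  assumes "\<phi> \<in> cochains_deg_over \<Gamma> p"
  shows "hochschild (hochschild \<phi>) = 0"
proof -
  let ?\<mu> = "multiplication :: 'n multiop"
  define e :: real where "e = (-1) ^ (p + 1)"
  have e: "(-1) ^ ((2 + 1) * (p + 1)) = e" "(-1) ^ ((p + 1) * (2 + 1)) = e" "e * e = 1"
    by (simp_all add: e_def minus_one_power_iff)
  have \<mu>: "?\<mu> \<in> cochains_deg_over {0} 2" by (rule multiplication_in_cochains_deg_over)
  note h = homogeneous_cochains_deg_over multilinear_cochains_deg_over
  have b: "bracket ?\<mu> \<phi> \<in> cochains_deg_over \<Gamma> (2 + p - 1)"
    "bracket \<phi> ?\<mu> \<in> cochains_deg_over \<Gamma> (p + 2 - 1)"
    using bracket_cochains_deg_over[OF \<mu> assms, of \<Gamma>] bracket_cochains_deg_over[OF assms \<mu>, of \<Gamma>]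
    by simp_all
  have "multilinear (bracket ?\<mu> ?\<mu>)"
    using bracket_cochains_deg_over[OF \<mu> \<mu>, of "{0}"] h(2) by auto
  then have "e *\<^sub>R bracket ?\<mu> (bracket ?\<mu> \<phi>) - bracket ?\<mu> (bracket \<phi> ?\<mu>)
      + e *\<^sub>R bracket \<phi> (bracket ?\<mu> ?\<mu>) = 0"
    using bracket_graded_jacobi[OF h[OF \<mu>] h[OF \<mu>] h[OF assms] h(2)[OF b(1)] h(2)[OF b(2)]]
    unfolding e by simp
  moreover have "bracket \<phi> ?\<mu> = (- e) *\<^sub>R bracket ?\<mu> \<phi>"
    using bracket_antisymmetric[OF h[OF assms] h[OF \<mu>]] unfolding e by simp
  ultimately have "(2 * e) *\<^sub>R bracket ?\<mu> (bracket ?\<mu> \<phi>) = 0"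
    unfolding bracket_multiplication_multiplication linear_0[OF linear_bracket_right[OF h(2)[OF assms]]]
    by (simp add: linear_scale[OF linear_bracket_right[OF multilinear_monop]] linear_neg[OF linear_bracket_right[OF multilinear_monop]] flip: scaleR_2)
  then have "bracket ?\<mu> (bracket ?\<mu> \<phi>) = 0" using e(3) by auto
  then show ?thesis
    unfolding hochschild_eq_bracket[OF h[OF assms]] linear_scale[OF linear_hochschild]
      hochschild_eq_bracket[OF h[OF b(1)]] by simp
qed

section \<open>Cochains with weights in a given set\<close>

lemma cochains_deg_eq: "cochains_deg p = cochains_deg_over UNIV p"
  by (simp add: cochains_deg_def cochains_deg_over_def)

lemma cochains_weight_eq: "cochains_weight w = span {monop a as | a as. weight a as = w}"
  by (simp add: cochains_weight_def weight_nth[symmetric] flip: vec_eq_iff)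

text \<open>Both sides are spanned by the monomial operators with weight in \<open>\<Delta>\<close>, grouped by weight on the
  left and by degree on the right.\<close>

lemma cochains_over_eq: "cochains_over \<Delta> = span (\<Union>p. cochains_deg_over \<Delta> p)"
proof (rule antisym)
  have "cochains_weight w \<subseteq> span (\<Union>p. cochains_deg_over \<Delta> p)" if "w \<in> \<Delta>" for w
    unfolding cochains_weight_eq
    using that by (intro span_minimal subspace_span) (auto intro!: span_base monop_in_cochains_deg_over)
  then show "cochains_over \<Delta> \<subseteq> span (\<Union>p. cochains_deg_over \<Delta> p)"
    unfolding cochains_over_def by (intro span_minimal subspace_span) blast
next
  have "monop a as \<in> cochains_over \<Delta>" if "weight a as \<in> \<Delta>" for a as
    using that unfolding cochains_over_def cochains_weight_eq by (blast intro: span_base)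
  then have "cochains_deg_over \<Delta> p \<subseteq> cochains_over \<Delta>" for p
    unfolding cochains_deg_over_def
    by (intro span_minimal) (auto simp: cochains_over_def)
  then show "span (\<Union>p. cochains_deg_over \<Delta> p) \<subseteq> cochains_over \<Delta>"
    by (intro span_minimal) (auto simp: cochains_over_def)
qed

lemma cochains_deg_over_subset: "cochains_deg_over \<Delta> p \<subseteq> cochains_over \<Delta>"
  unfolding cochains_over_eq by (blast intro: span_base)

lemma subspace_cochains_over: "subspace (cochains_over \<Delta>)"
  by (simp add: cochains_over_def)

lemma cochains_over_induct [consumes 1, case_names subspace homogeneous]:
  assumes "\<phi> \<in> cochains_over \<Delta>" "subspace {\<phi>. P \<phi>}"
    and "\<And>p \<phi>. \<phi> \<in> cochains_deg_over \<Delta> p \<Longrightarrow> P \<phi>"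
  shows "P \<phi>"
  using assms(1) unfolding cochains_over_eq by (rule span_induct) (use assms in auto)

lemma multilinear_cochains_over: "\<phi> \<in> cochains_over \<Delta> \<Longrightarrow> multilinear \<phi>"
  by (induction rule: cochains_over_induct)
    (auto intro: subspace_multilinear multilinear_cochains_deg_over)

text \<open>Monomial operators have a degree as well as a weight, so restricting the weights leaves a
  graded subspace.\<close>

lemma cochains_over_graded:
  "cochains_over \<Delta> = span (\<Union>p. cochains_over \<Delta> \<inter> cochains_deg p)"
proof (rule antisym)
  have "cochains_deg_over \<Delta> p \<subseteq> cochains_over \<Delta> \<inter> cochains_deg p" for p
    using cochains_deg_over_subset cochains_deg_over_mono[of \<Delta> UNIV] by (auto simp: cochains_deg_eq)
  then show "cochains_over \<Delta> \<subseteq> span (\<Union>p. cochains_over \<Delta> \<inter> cochains_deg p)"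
    by (subst cochains_over_eq) (intro span_mono, blast)
  show "span (\<Union>p. cochains_over \<Delta> \<inter> cochains_deg p) \<subseteq> cochains_over \<Delta>"
    by (intro span_minimal subspace_cochains_over) auto
qed

lemma cochains_over_subset_cochains: "cochains_over \<Delta> \<subseteq> cochains"
  unfolding cochains_def by (subst cochains_over_graded) (intro span_mono, blast)

lemma cup_closed_cochains_over:
  assumes add: "\<And>a b. a \<in> \<Delta> \<Longrightarrow> b \<in> \<Delta> \<Longrightarrow> a + b \<in> \<Delta>"
    and "\<phi> \<in> cochains_over \<Delta>" "\<psi> \<in> cochains_over \<Delta>"
  shows "cup \<phi> \<psi> \<in> cochains_over \<Delta>"
  using assms(2)
proof (induction rule: cochains_over_induct)
  case subspace
  show ?case using linear_subspace_vimage[OF linear_cup_left subspace_cochains_over]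
    by (simp add: vimage_def)
next
  case (homogeneous p \<phi>)
  show ?case using assms(3)
  proof (induction rule: cochains_over_induct)
    case subspace
    show ?case using linear_subspace_vimage[OF linear_cup_right subspace_cochains_over]
      by (simp add: vimage_def)
  next
    case (homogeneous q \<psi>)
    from cup_cochains_deg_over[OF \<open>\<phi> \<in> cochains_deg_over \<Delta> p\<close> this add] show ?case
      using cochains_deg_over_subset by blast
  qed
qed

lemma bracket_closed_cochains_over:
  assumes add: "\<And>a b. a \<in> \<Delta> \<Longrightarrow> b \<in> \<Delta> \<Longrightarrow> a + b \<in> \<Delta>"
    and "\<phi> \<in> cochains_over \<Delta>" "\<psi> \<in> cochains_over \<Delta>"
  shows "bracket \<phi> \<psi> \<in> cochains_over \<Delta>"
  using assms(2)
proof (induction rule: cochains_over_induct)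
  case subspace
  show ?case
    using linear_subspace_vimage[OF linear_bracket_left[OF multilinear_cochains_over[OF assms(3)]]
        subspace_cochains_over]
    by (simp add: vimage_def)
next
  case (homogeneous p \<phi>)
  show ?case using assms(3)
  proof (induction rule: cochains_over_induct)
    case subspace
    show ?case
      using linear_subspace_vimage[OF linear_bracket_right[OF
            multilinear_cochains_deg_over[OF \<open>\<phi> \<in> cochains_deg_over \<Delta> p\<close>]] subspace_cochains_over]
      by (simp add: vimage_def)
  next
    case (homogeneous q \<psi>)
    from bracket_cochains_deg_over[OF \<open>\<phi> \<in> cochains_deg_over \<Delta> p\<close> this add] show ?case
      using cochains_deg_over_subset by blast
  qed
qed

lemma hochschild_closed_cochains_over:
  assumes "\<phi> \<in> cochains_over \<Delta>"
  shows "hochschild \<phi> \<in> cochains_over \<Delta>"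
  using assms
proof (induction rule: cochains_over_induct)
  case subspace
  show ?case using linear_subspace_vimage[OF linear_hochschild subspace_cochains_over]
    by (simp add: vimage_def)
next
  case (homogeneous p \<phi>)
  then show ?case using hochschild_cochains_deg_over cochains_deg_over_subset by blast
qed

lemma hochschild_hochschild:
  assumes "\<phi> \<in> cochains_over \<Delta>"
  shows "hochschild (hochschild \<phi>) = 0"
  using assms
proof (induction rule: cochains_over_induct)
  case subspace
  have "linear (\<lambda>\<phi> :: 'a multiop. hochschild (hochschild \<phi>))"
    using linear_compose[OF linear_hochschild linear_hochschild] by (simp only: o_def)
  then show ?case by (rule linear_subspace_kernel)
qed (rule hochschild_hochschild_deg)

theorem theorem1:
  fixes \<Delta> :: "(int ^ 'n::finite) set"
  assumes "\<And>a b. a \<in> \<Delta> \<Longrightarrow> b \<in> \<Delta> \<Longrightarrow> a + b \<in> \<Delta>"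
  shows "(\<forall>\<phi>\<in>cochains_over \<Delta>. \<forall>\<psi>\<in>cochains_over \<Delta>. cup \<phi> \<psi> \<in> cochains_over \<Delta>)
    \<and> (\<forall>\<phi>\<in>cochains_over \<Delta>. \<forall>\<psi>\<in>cochains_over \<Delta>. bracket \<phi> \<psi> \<in> cochains_over \<Delta>)
    \<and> (\<forall>\<phi>\<in>cochains_over \<Delta>. hochschild \<phi> \<in> cochains_over \<Delta>)
    \<and> differential_gerstenhaber_algebra (cochains_over \<Delta>)"
proof -
  let ?S = "cochains_over \<Delta>"
  have cup: "cup \<phi> \<psi> \<in> ?S" if "\<phi> \<in> ?S" "\<psi> \<in> ?S" for \<phi> \<psi>
    using assms that by (rule cup_closed_cochains_over)
  have bracket: "bracket \<phi> \<psi> \<in> ?S" if "\<phi> \<in> ?S" "\<psi> \<in> ?S" for \<phi> \<psi>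
    using assms that by (rule bracket_closed_cochains_over)
  note closed = cup bracket hochschild_closed_cochains_over
  have hom: "homogeneous p \<phi>" if "\<phi> \<in> ?S \<inter> cochains_deg p" for p and \<phi> :: "'n multiop"
    using that homogeneous_cochains_deg_over by (auto simp: cochains_deg_eq)
  have mult: "multilinear \<phi>" if "\<phi> \<in> ?S \<inter> cochains_deg p" for p and \<phi> :: "'n multiop"
    using that multilinear_cochains_over by auto
  have deg: "bracket \<phi> \<psi> \<in> cochains_deg (p + q - 1)"
    if "\<phi> \<in> ?S \<inter> cochains_deg p" "\<psi> \<in> ?S \<inter> cochains_deg q" for p q and \<phi> \<psi> :: "'n multiop"
    using that bracket_cochains_deg_over[of \<phi> UNIV p \<psi> UNIV q UNIV] by (simp add: cochains_deg_eq)
  have "differential_gerstenhaber_algebra ?S"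
  proof
    fix \<phi> \<psi> \<xi> :: "'n multiop" and p q r :: nat
    assume 1: "\<phi> \<in> ?S \<inter> cochains_deg p" and 2: "\<psi> \<in> ?S \<inter> cochains_deg q"
    show "cup \<phi> \<psi> \<in> cochains_deg (p + q)"
      using 1 2 cup_cochains_deg_over[of \<phi> UNIV p \<psi> UNIV q UNIV] by (simp add: cochains_deg_eq)
    show "bracket \<phi> \<psi> = - ((-1) ^ ((p + 1) * (q + 1)) *\<^sub>R bracket \<psi> \<phi>)"
      using bracket_antisymmetric[OF hom[OF 1] mult[OF 1] hom[OF 2] mult[OF 2]] .
    show "bracket \<phi> \<psi> \<in> cochains_deg r" if "p + q = r + 1"
      using deg[OF 1 2] that by simp
    assume 3: "\<xi> \<in> ?S \<inter> cochains_deg r"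
    have "multilinear (bracket f g)" if "f \<in> ?S" "g \<in> ?S" for f g
      using closed(2)[OF that] by (rule multilinear_cochains_over)
    with 1 2 3 show "(-1) ^ ((p + 1) * (r + 1)) *\<^sub>R bracket \<phi> (bracket \<psi> \<xi>)
          + (-1) ^ ((q + 1) * (p + 1)) *\<^sub>R bracket \<psi> (bracket \<xi> \<phi>)
          + (-1) ^ ((r + 1) * (q + 1)) *\<^sub>R bracket \<xi> (bracket \<phi> \<psi>) = 0"
      by (intro bracket_graded_jacobi[OF hom[OF 1] mult[OF 1] hom[OF 2] mult[OF 2] hom[OF 3] mult[OF 3]])
        auto
  next
    fix \<phi> \<psi> :: "'n multiop"
    assume 1: "\<phi> \<in> ?S \<inter> cochains_deg 0" and 2: "\<psi> \<in> ?S \<inter> cochains_deg 0"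
    show "bracket \<phi> \<psi> = 0"
      unfolding bracket_eq_circ[OF hom[OF 1] mult[OF 1] hom[OF 2] mult[OF 2]]
      by (auto simp: circ_def)
  next
    fix \<phi> :: "'n multiop" and p
    assume "\<phi> \<in> ?S \<inter> cochains_deg p"
    then show "hochschild \<phi> \<in> cochains_deg (p + 1)"
      using hochschild_cochains_deg_over by (auto simp: cochains_deg_eq)
  next
    fix \<phi> \<phi>' \<psi> :: "'n multiop" and c :: real
    show "cup (c *\<^sub>R \<phi> + \<phi>') \<psi> = c *\<^sub>R cup \<phi> \<psi> + cup \<phi>' \<psi>"
      by (simp add: linear_add[OF linear_cup_left] linear_scale[OF linear_cup_left])
    show "cup \<psi> (c *\<^sub>R \<phi> + \<phi>') = c *\<^sub>R cup \<psi> \<phi> + cup \<psi> \<phi>'"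
      by (simp add: linear_add[OF linear_cup_right] linear_scale[OF linear_cup_right])
    show "hochschild (c *\<^sub>R \<phi> + \<phi>') = c *\<^sub>R hochschild \<phi> + hochschild \<phi>'"
      by (simp add: linear_add[OF linear_hochschild] linear_scale[OF linear_hochschild])
    assume "\<psi> \<in> ?S"
    then have "multilinear \<psi>" by (rule multilinear_cochains_over)
    note l = linear_bracket_left[OF this] linear_bracket_right[OF this]
    show "bracket (c *\<^sub>R \<phi> + \<phi>') \<psi> = c *\<^sub>R bracket \<phi> \<psi> + bracket \<phi>' \<psi>"
      by (simp add: linear_add[OF l(1)] linear_scale[OF l(1)])
    show "bracket \<psi> (c *\<^sub>R \<phi> + \<phi>') = c *\<^sub>R bracket \<psi> \<phi> + bracket \<psi> \<phi>'"
      by (simp add: linear_add[OF l(2)] linear_scale[OF l(2)])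
  next
    show "subspace ?S" by (rule subspace_cochains_over)
    show "?S \<subseteq> cochains" by (rule cochains_over_subset_cochains)
    show "?S = span (\<Union>p. ?S \<inter> cochains_deg p)" by (rule cochains_over_graded)
    fix \<phi> \<psi> \<xi> :: "'n multiop"
    show "cup (cup \<phi> \<psi>) \<xi> = cup \<phi> (cup \<psi> \<xi>)" by (rule cup_assoc)
    assume 1: "\<phi> \<in> ?S"
    show "hochschild \<phi> \<in> ?S" by (rule closed(3)[OF 1])
    show "hochschild (hochschild \<phi>) = 0" by (rule hochschild_hochschild[OF 1])
    assume 2: "\<psi> \<in> ?S"
    show "cup \<phi> \<psi> \<in> ?S" by (rule closed(1)[OF 1 2])
    show "bracket \<phi> \<psi> \<in> ?S" by (rule closed(2)[OF 1 2])
  qed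
  with closed show ?thesis by blast
qed

end
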